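(* Let $f_1,f_2:\mathbb R^+\to\mathbb R^+$ be continuous and strictly increasing with $f_i(x)>0$ for $x>0$, $i=1,2$. Assume that the equation $f_1^{-1}(x)=f_2(x)$ has exactly one positive solution $K>0$, where $f_2(x)>f_1^{-1}(x)$ for $f_1(0)<x<K$ and $f_2(x)<f_1^{-1}(x)$ for $x>K$. Let $h_i:\mathbb R^+\to\mathbb R$ ($i=1,2$) be Lebesgue measurable with $h_i(t)\le t$ and $\lim_{t\to\infty}h_i(t)=\infty$. For $i=1,2$ let $R_i(t,\cdot)$ be left continuous and non-decreasing for any $t$, let $R_i(\cdot,s)$ be locally integrable for any $s$, let $R_i(t,s)=0$ for $s\le h_i(t)$ and $R_i(t,t^+)=1$, and let $r_i$ be a Lebesgue measurable essentially bounded function on $\mathbb R^+$ with $r_i(t)\ge 0$ and $\int_0^\infty r_i(s)\,ds=\infty$. Let $\varphi,\psi:(-\infty,0]\to\mathbb R$ be continuous bounded functions with $\varphi(t)\ge 0$, $\psi(t)\ge 0$ for $t<0$ and $\varphi(0)>0$, $\psi(0)>0$. Let $G_1,G_2:\mathbb R^+\to\mathbb R^+$ be continuous with $G_i(x)>0$ for $x>0$. Then any solution of the initial value problem (PG) described in the context converges to the unique positive equilibrium: $(x(t),y(t))\to(K,f_2(K))$ as $t\to\infty$.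
   Context: $\mathbb R^+=[0,\infty)$; $u(t^+)$ is the right-side limit of $u$ at $t$. Problem (PG) is the system $$x'(t)=r_1(t)G_1(x(t))\left[\int_{h_1(t)}^t f_1(y(s))\,d_sR_1(t,s)-x(t)\right],\quad y'(t)=r_2(t)G_2(y(t))\left[\int_{h_2(t)}^t f_2(x(s))\,d_sR_2(t,s)-y(t)\right]$$ with the initial conditions $x(t)=\varphi(t)$, $y(t)=\psi(t)$ for $t\le 0$. The integrals are Stieltjes integrals in $s$ over $[h_i(t),t]$ including the endpoint atoms, i.e. with respect to the probability measure on $[h_i(t),t]$ with (left continuous) distribution function $R_i(t,\cdot)$. A solution is a pair $(x,y)$, locally absolutely continuous on $[0,\infty)$, which satisfies the system for almost all $t\ge0$ and the initial conditions for $t\le0$. Convention: $f_1^{-1}$ is the inverse of $f_1$ on its range, $f_1^{-1}(x)=0$ for $0\le x<f_1(0)$, and $f_1^{-1}(x)=+\infty$ for $x$ above the range of $f_1$. *)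

theory Defs
  imports "HOL-Analysis.Analysis"
begin

(* The inverse of f : [0,\<infinity>) \<rightarrow> [0,\<infinity>) extended to all x \<ge> 0, with values in [0,\<infinity>].
   For continuous strictly increasing f the range is an interval starting at f 0,
   so the last case is that of x above the range. *)
definition ext_inverse :: "(real \<Rightarrow> real) \<Rightarrow> real \<Rightarrow> ereal" where
  "ext_inverse f x =
     (if x < f 0 then 0
      else if x \<in> f ` {0..} then ereal (the_inv_into {0..} f x)
      else \<infinity>)"

definition admissible_delay :: "(real \<Rightarrow> real) \<Rightarrow> bool" where
  "admissible_delay h \<longleftrightarrow>
     h \<in> borel_measurable (lebesgue_on {0..}) \<and>
     (\<forall>t\<ge>0. h t \<le> t) \<and>
     filterlim h at_top at_top"

definition admissible_kernel :: "(real \<Rightarrow> real) \<Rightarrow> (real \<Rightarrow> real \<Rightarrow> real) \<Rightarrow> bool" where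
  "admissible_kernel h R \<longleftrightarrow>
     (\<forall>t\<ge>0. \<forall>s. continuous (at_left s) (R t)) \<and>
     (\<forall>t\<ge>0. mono (R t)) \<and>
     (\<forall>s. \<forall>T\<ge>0. set_integrable lebesgue {0..T} (\<lambda>t. R t s)) \<and>
     (\<forall>t\<ge>0. \<forall>s\<le>h t. R t s = 0) \<and>
     (\<forall>t\<ge>0. (R t \<longlongrightarrow> 1) (at_right t))"

definition admissible_rate :: "(real \<Rightarrow> real) \<Rightarrow> bool" where
  "admissible_rate r \<longleftrightarrow>
     r \<in> borel_measurable (lebesgue_on {0..}) \<and>
     (\<exists>C. AE t in lebesgue_on {0..}. \<bar>r t\<bar> \<le> C) \<and>
     (\<forall>t\<ge>0. 0 \<le> r t) \<and>
     (\<integral>\<^sup>+ t. ennreal (r t) \<partial>lebesgue_on {0..}) = \<infinity>"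

(* Lebesgue-Stieltjes measure of a non-decreasing left continuous F, giving [a,b) the
   mass F b - F a.  Since interval_measure expects a right continuous function, F is
   replaced by s \<mapsto> F(s+). *)
definition left_stieltjes_measure :: "(real \<Rightarrow> real) \<Rightarrow> real measure" where
  "left_stieltjes_measure F = interval_measure (\<lambda>s. Lim (at_right s) F)"

(* The Stieltjes integral of g over the closed interval [a,b], atoms at a and b included:
   the mass of [a,b] is F(b+) - F(a). *)
definition stieltjes_integral :: "(real \<Rightarrow> real) \<Rightarrow> real \<Rightarrow> real \<Rightarrow> (real \<Rightarrow> real) \<Rightarrow> real" where
  "stieltjes_integral F a b g = (LINT s:{a..b}|left_stieltjes_measure F. g s)"

definition abs_continuous_on :: "real \<Rightarrow> real \<Rightarrow> (real \<Rightarrow> real) \<Rightarrow> bool" where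
  "abs_continuous_on a b u \<longleftrightarrow>
     (\<forall>\<epsilon>>0. \<exists>\<delta>>0. \<forall>D :: (real \<times> real) set.
        finite D \<and> (\<forall>(c, d)\<in>D. a \<le> c \<and> c < d \<and> d \<le> b) \<and>
        disjoint_family_on (\<lambda>(c, d). {c<..<d}) D \<and>
        (\<Sum>(c, d)\<in>D. d - c) < \<delta>
        \<longrightarrow> (\<Sum>(c, d)\<in>D. \<bar>u d - u c\<bar>) < \<epsilon>)"

definition locally_abs_continuous :: "(real \<Rightarrow> real) \<Rightarrow> bool" where
  "locally_abs_continuous u \<longleftrightarrow> (\<forall>T>0. abs_continuous_on 0 T u)"

(* u' = r G(u) (\<integral> f(v(s)) d_s R(t,s) - u) for almost all t \<ge> 0 *)
definition satisfies_equation ::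
  "(real \<Rightarrow> real) \<Rightarrow> (real \<Rightarrow> real) \<Rightarrow> (real \<Rightarrow> real) \<Rightarrow> (real \<Rightarrow> real) \<Rightarrow> (real \<Rightarrow> real \<Rightarrow> real)
   \<Rightarrow> (real \<Rightarrow> real) \<Rightarrow> (real \<Rightarrow> real) \<Rightarrow> bool" where
  "satisfies_equation r G f h R u v \<longleftrightarrow>
     (AE t in lebesgue. 0 \<le> t \<longrightarrow>
        (u has_real_derivative
           r t * G (u t) * (stieltjes_integral (R t) (h t) t (\<lambda>s. f (v s)) - u t)) (at t))"

definition PG_solution ::
  "(real \<Rightarrow> real) \<Rightarrow> (real \<Rightarrow> real) \<Rightarrow> (real \<Rightarrow> real) \<Rightarrow> (real \<Rightarrow> real) \<Rightarrow> (real \<Rightarrow> real \<Rightarrow> real)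
   \<Rightarrow> (real \<Rightarrow> real) \<Rightarrow> (real \<Rightarrow> real) \<Rightarrow> (real \<Rightarrow> real) \<Rightarrow> (real \<Rightarrow> real) \<Rightarrow> (real \<Rightarrow> real \<Rightarrow> real)
   \<Rightarrow> (real \<Rightarrow> real) \<Rightarrow> (real \<Rightarrow> real) \<Rightarrow> (real \<Rightarrow> real) \<Rightarrow> (real \<Rightarrow> real) \<Rightarrow> bool" where
  "PG_solution r1 G1 f1 h1 R1 r2 G2 f2 h2 R2 \<phi> \<psi> x y \<longleftrightarrow>
     locally_abs_continuous x \<and> locally_abs_continuous y \<and>
     satisfies_equation r1 G1 f1 h1 R1 x y \<and>
     satisfies_equation r2 G2 f2 h2 R2 y x \<and>
     (\<forall>t\<le>0. x t = \<phi> t \<and> y t = \<psi> t)"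

end

theory Submission
  imports Defs
begin

text \<open>Absolutely continuous functions obey the fundamental theorem of calculus, so each equation reads
  \<open>u t - u s = \<integral> w (I - u)\<close> with a weight \<open>w \<ge> 0\<close> and an input \<open>I\<close> that is an average of past values of
  \<open>f \<circ> v\<close>. Hence \<open>u\<close> cannot cross upwards a level that bounds the input from above, and since the rate
  has infinite integral, \<open>u\<close> is eventually pushed below any larger level; symmetrically from below.

  Put \<open>g = f1 \<circ> f2\<close>. The hypotheses on \<open>f1\<^sup>-\<^sup>1\<close> say that \<open>g u > u\<close> for \<open>0 < u < K\<close> and \<open>g u < u\<close> for \<open>u > K\<close>.
  This yields boxes that trap \<open>(x, y)\<close> away from \<open>0\<close> and \<open>\<infinity>\<close>. An eventual upper bound \<open>a\<close> of \<open>x\<close> gives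
  the eventual upper bounds \<open>f2 a + \<epsilon>\<close> of \<open>y\<close> and \<open>g a + \<epsilon>\<close> of \<open>x\<close>, so the infimum of these bounds
  cannot exceed \<open>K\<close>; likewise for lower bounds.\<close>

section \<open>Absolutely continuous functions\<close>

text \<open>Absolute continuity is stated for sets of pairs \<open>c < d\<close> with disjoint open
  intervals, whereas the cells of a tagged division are closed, may degenerate to a point and carry
  tags. Degenerate cells contribute nothing; the others are determined by their end points, because
  their interiors are nonempty and disjoint, so the sums can be reindexed.\<close>

lemma abs_continuous_on_sum_tagged:
  assumes p: "p tagged_division_of {a..b}" and q: "q \<subseteq> p"
    and small: "(\<Sum>(x, K)\<in>q. Sup K - Inf K) < \<delta>"
    and \<delta>: "\<And>D :: (real \<times> real) set.
        finite D \<and> (\<forall>(c, d)\<in>D. a \<le> c \<and> c < d \<and> d \<le> b) \<and>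
        disjoint_family_on (\<lambda>(c, d). {c<..<d}) D \<and>
        (\<Sum>(c, d)\<in>D. d - c) < \<delta>
        \<Longrightarrow> (\<Sum>(c, d)\<in>D. \<bar>u d - u c\<bar>) < \<epsilon>"
  shows "(\<Sum>(x, K)\<in>q. \<bar>u (Sup K) - u (Inf K)\<bar>) < (\<epsilon> :: real)"
proof -
  define q' where "q' = {xK \<in> q. Inf (snd xK) < Sup (snd xK)}"
  define e where "e = (\<lambda>xK :: real \<times> real set. (Inf (snd xK), Sup (snd xK)))"
  have fin: "finite p" "finite q" "finite q'"
    using p q by (auto simp: q'_def intro: finite_subset)
  have intv: "\<exists>c d. K = {c..d} \<and> c \<le> d \<and> a \<le> c \<and> d \<le> b \<and> Inf K = c \<and> Sup K = d"
    if "(x, K) \<in> q" for x K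
  proof -
    have "x \<in> K" "K \<subseteq> {a..b}" "\<exists>c d. K = cbox c d"
      using p q that by blast+
    then obtain c d where "K = {c..d}" "c \<le> d"
      by auto
    with \<open>K \<subseteq> {a..b}\<close> show ?thesis
      by (intro exI[of _ c] exI[of _ d]) auto
  qed
  have disj: "{Inf K<..<Sup K} \<inter> {Inf L<..<Sup L} = {}"
    if xy: "(x, K) \<in> q" "(y, L) \<in> q" "(x, K) \<noteq> (y, L)" for x y K L
  proof -
    have "interior K \<inter> interior L = {}"
      using p q xy by blast
    moreover obtain c d where "K = {c..d}" "c \<le> d"
      using intv[OF xy(1)] by blast
    moreover obtain c' d' where "L = {c'..d'}" "c' \<le> d'"
      using intv[OF xy(2)] by blast
    ultimately show ?thesis
      by simp
  qed
  have inj: "inj_on e q'"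
  proof (rule inj_onI, clarsimp simp: q'_def e_def)
    fix x K y L
    assume "(x, K) \<in> q" "(y, L) \<in> q" "Inf L < Sup L" "Inf K = Inf L" "Sup K = Sup L"
    then show "x = y \<and> K = L"
      using disj[of x K y L] by fastforce
  qed
  \<comment> \<open>Kept general in \<open>g\<close> because it is needed twice, for the lengths and
    for the increments of \<open>u\<close>.\<close>
  have eq: "(\<Sum>(x, K)\<in>q. g (Inf K) (Sup K)) = (\<Sum>(c, d)\<in>e ` q'. g c d)"
    if "\<And>c. g c c = 0" for g :: "real \<Rightarrow> real \<Rightarrow> real"
  proof -
    have "(\<Sum>(c, d)\<in>e ` q'. g c d) = (\<Sum>(x, K)\<in>q'. g (Inf K) (Sup K))"
      by (subst sum.reindex[OF inj]) (simp add: e_def case_prod_beta)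
    also have "\<dots> = (\<Sum>(x, K)\<in>q. g (Inf K) (Sup K))"
    proof (rule sum.mono_neutral_left)
      show "\<forall>i\<in>q - q'. (case i of (x, K) \<Rightarrow> g (Inf K) (Sup K)) = 0"
      proof safe
        fix x K
        assume "(x, K) \<in> q" "(x, K) \<notin> q'"
        then have "Inf K = Sup K"
          using intv[of x K] by (auto simp: q'_def)
        then show "g (Inf K) (Sup K) = 0"
          using that by simp
      qed
    qed (use fin in \<open>auto simp: q'_def\<close>)
    finally show ?thesis ..
  qed
  have "(\<Sum>(c, d)\<in>e ` q'. \<bar>u d - u c\<bar>) < \<epsilon>"
  proof (rule \<delta>, intro conjI)
    show "\<forall>(c, d)\<in>e ` q'. a \<le> c \<and> c < d \<and> d \<le> b"
    proof (clarsimp simp: q'_def e_def)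
      fix x K
      assume "(x, K) \<in> q"
      from intv[OF this] show "a \<le> Inf K \<and> Sup K \<le> b"
        by metis
    qed
    show "disjoint_family_on (\<lambda>(c, d). {c<..<d}) (e ` q')"
      unfolding disjoint_family_on_def
    proof (intro ballI impI)
      fix m n
      assume "m \<in> e ` q'" "n \<in> e ` q'" "m \<noteq> n"
      then show "(case m of (c, d) \<Rightarrow> {c<..<d}) \<inter> (case n of (c, d) \<Rightarrow> {c<..<d}) = {}"
        using disj by (fastforce simp: e_def q'_def)
    qed
    show "(\<Sum>(c, d)\<in>e ` q'. d - c) < \<delta>"
      using eq[of "\<lambda>c d. d - c"] small by simp
  qed (use fin in auto)
  then show ?thesis
    using eq[of "\<lambda>c d. \<bar>u d - u c\<bar>"] by simp
qed

text \<open>Passing to interiors keeps every length and makes the cells disjoint, so the sum is the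
  measure of a union contained in \<open>U\<close>.\<close>

lemma sum_tagged_le_measure:
  assumes p: "p tagged_division_of {a..b}" and q: "q \<subseteq> p"
    and U: "\<And>x K. (x, K) \<in> q \<Longrightarrow> K \<subseteq> U" "U \<in> lmeasurable"
  shows "(\<Sum>(x, K)\<in>q. Sup K - Inf K) \<le> measure lebesgue (U :: real set)"
proof -
  have fin: "finite q"
    using p q by (auto intro: finite_subset)
  have intv: "\<exists>c d. K = {c..d} \<and> c \<le> d" if "(x, K) \<in> q" for x K
  proof -
    have "x \<in> K" "\<exists>c d. K = cbox c d"
      using p q that by blast+
    then show ?thesis
      by auto
  qed
  have "(\<Sum>(x, K)\<in>q. Sup K - Inf K) = (\<Sum>xK\<in>q. measure lebesgue (interior (snd xK)))"
  proof (rule sum.cong, safe)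
    fix x K
    assume "(x, K) \<in> q"
    then obtain c d where "K = {c..d}" "c \<le> d"
      using intv by blast
    then show "Sup K - Inf K = measure lebesgue (interior (snd (x, K)))"
      by simp
  qed
  also have "\<dots> = measure lebesgue (\<Union>xK\<in>q. interior (snd xK))"
  proof (rule measure_UNION'[symmetric, OF fin])
    fix xK
    assume "xK \<in> q"
    then obtain c d where "snd xK = {c..d}" "c \<le> d"
      using intv by (metis prod.collapse)
    then show "interior (snd xK) \<in> lmeasurable"
      by simp
  next
    show "pairwise (\<lambda>i j. disjnt (interior (snd i)) (interior (snd j))) q"
      unfolding pairwise_def disjnt_def
    proof (intro ballI impI)
      fix i j
      assume "i \<in> q" "j \<in> q" "i \<noteq> j"
      with q have "(fst i, snd i) \<in> p" "(fst j, snd j) \<in> p" "(fst i, snd i) \<noteq> (fst j, snd j)"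
        by auto
      then show "interior (snd i) \<inter> interior (snd j) = {}"
        by (rule tagged_division_ofD(5)[OF p])
    qed
  qed
  also have "\<dots> \<le> measure lebesgue U"
  proof (rule measure_mono_fmeasurable)
    show "(\<Union>xK\<in>q. interior (snd xK)) \<subseteq> U"
      using U(1) interior_subset by fastforce
    show "(\<Union>xK\<in>q. interior (snd xK)) \<in> sets lebesgue"
      by (intro sets.finite_UN fin) auto
  qed (use U in auto)
  finally show ?thesis .
qed

text \<open>Tags in the exceptional null set are confined to an open set of small measure, where absolute
  continuity controls the increments; all other tags are handled by differentiability.\<close>

theorem abs_continuous_fundamental_theorem:
  assumes ab: "a \<le> b" and ac: "abs_continuous_on a b u"
    and N: "negligible N"
    and deriv: "\<And>t. t \<in> {a..b} - N \<Longrightarrow> (u has_real_derivative u' t) (at t within {a..b})"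
  shows "(u' has_integral (u b - u a)) {a..b}"
proof -
  \<comment> \<open>With the integrand set to 0 on \<open>N\<close>, the error of a cell tagged in
    \<open>N\<close> is just the increment of \<open>u\<close>.\<close>
  define f where "f = (\<lambda>t. if t \<in> N then 0 else u' t)"
  have "(f has_integral (u b - u a)) {a..b}"
    unfolding has_integral_real
  proof (intro allI impI)
    fix \<epsilon> :: real
    assume "\<epsilon> > 0"
    \<comment> \<open>Half of \<open>\<epsilon>\<close> goes to the differentiable tags, half to
      those in \<open>N\<close>; the \<open>+ 1\<close> covers \<open>a = b\<close> and makes the
      first half strict.\<close>
    define e where "e = \<epsilon> / (2 * (b - a + 1))"
    have e: "e > 0" "e * (b - a) < \<epsilon> / 2"
      using \<open>\<epsilon> > 0\<close> ab by (auto simp: e_def field_simps)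
    from ac[unfolded abs_continuous_on_def, THEN spec, THEN mp, OF half_gt_zero[OF \<open>\<epsilon> > 0\<close>]]
    obtain \<delta> where "\<delta> > 0" and \<delta>:
      "\<And>D :: (real \<times> real) set.
        finite D \<and> (\<forall>(c, d)\<in>D. a \<le> c \<and> c < d \<and> d \<le> b) \<and>
        disjoint_family_on (\<lambda>(c, d). {c<..<d}) D \<and>
        (\<Sum>(c, d)\<in>D. d - c) < \<delta>
        \<Longrightarrow> (\<Sum>(c, d)\<in>D. \<bar>u d - u c\<bar>) < \<epsilon> / 2"
      by (elim exE conjE) (rule that, assumption, drule spec, erule mp)
    have Nn: "N \<in> null_sets lebesgue"
      using N by (simp add: negligible_iff_null_sets)
    then obtain U where U: "open U" "N \<subseteq> U" "U - N \<in> lmeasurable" "emeasure lebesgue (U - N) < ennreal \<delta>"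
      using sets_lebesgue_outer_open[of N \<delta>] \<open>\<delta> > 0\<close> by auto
    have Um: "U \<in> sets lebesgue"
      using U(1) by auto
    have "emeasure lebesgue U < ennreal \<delta>"
      using emeasure_Diff_null_set[OF Nn Um] U(4) by simp
    moreover from this have Ul: "U \<in> lmeasurable"
      using Um by (intro fmeasurableI) (auto intro: less_trans)
    ultimately have Ud: "measure lebesgue U < \<delta>"
      by (simp add: emeasure_eq_measure2 ennreal_less_iff)
    have "\<exists>d>0. t \<in> {a..b} - N \<longrightarrow>
         (\<forall>y\<in>{a..b}. norm (y-t) < d \<longrightarrow> norm (u y - u t - u' t * (y-t)) \<le> e * norm (y-t))" for t
    proof (cases "t \<in> {a..b} - N")
      case True
      then show ?thesis
        using deriv[OF True] \<open>e > 0\<close>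
        unfolding has_field_derivative_def has_derivative_within_alt by simp
    qed (auto intro: exI[of _ 1])
    then obtain d where d: "\<And>t. 0 < d t"
      "\<And>t y. \<lbrakk>t \<in> {a..b} - N; y \<in> {a..b}; norm (y-t) < d t\<rbrakk>
                        \<Longrightarrow> norm (u y - u t - u' t * (y-t)) \<le> e * norm (y-t)"
      by metis
    define \<gamma> where "\<gamma> = (\<lambda>t. if t \<in> N then U else ball t (d t))"
    have gauge: "gauge \<gamma>"
      using d(1) U(1,2) by (auto simp: gauge_def \<gamma>_def)
    have fine: "norm (sum (\<lambda>(x,k). measure lborel k *\<^sub>R f x) p - (u b - u a)) < \<epsilon>"
      if p: "p tagged_division_of {a..b}" "\<gamma> fine p" for p
    proof -
      define q where "q = {xK \<in> p. fst xK \<in> N}"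
      have fin: "finite p" "q \<subseteq> p" "finite q"
        using p by (auto simp: q_def)
      have ba: "b - a = (\<Sum>(x,K)\<in>p. Sup K - Inf K)" "u b - u a = (\<Sum>(x,K)\<in>p. u(Sup K) - u(Inf K))"
        using additive_tagged_division_1[OF ab p(1), of "\<lambda>x. x"]
          additive_tagged_division_1[OF ab p(1), of u] by auto
      have intv: "\<exists>c v. K = {c..v} \<and> c \<le> v \<and> {c..v} \<subseteq> {a..b} \<and> x \<in> {c..v} \<and> K \<subseteq> \<gamma> x \<and> Inf K = c \<and> Sup K = v"
        if "(x, K) \<in> p" for x K
      proof -
        have "x \<in> K" "K \<subseteq> {a..b}" "\<exists>c v. K = cbox c v" "K \<subseteq> \<gamma> x"
          using p that by blast+
        then show ?thesis
          by (auto intro!: exI)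
      qed
      have "(\<Sum>(x, K)\<in>q. Sup K - Inf K) \<le> measure lebesgue U"
        using p(1) fin(2)
      proof (rule sum_tagged_le_measure)
        show "K \<subseteq> U" if "(x, K) \<in> q" for x K
          using intv[of x K] that by (auto simp: q_def \<gamma>_def)
      qed (fact Ul)
      then have small: "(\<Sum>(x, K)\<in>q. \<bar>u (Sup K) - u (Inf K)\<bar>) < \<epsilon> / 2"
        using Ud by (intro abs_continuous_on_sum_tagged[OF p(1) fin(2) _ \<delta>]) auto
      have "norm (sum (\<lambda>(x,k). measure lborel k *\<^sub>R f x) p - (u b - u a))
          = norm (\<Sum>(x,K)\<in>p. measure lborel K *\<^sub>R f x - (u (Sup K) - u (Inf K)))"
        unfolding ba sum_subtractf[symmetric] by (simp add: case_prod_beta)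
      also have "\<dots> \<le> (\<Sum>(x,K)\<in>p. e * (Sup K - Inf K) + (if x \<in> N then \<bar>u (Sup K) - u (Inf K)\<bar> else 0))"
      proof (rule sum_norm_le, safe)
        fix x K
        assume xK: "(x, K) \<in> p"
        then obtain c v where K: "K = {c..v}" "c \<le> v" "{c..v} \<subseteq> {a..b}" "x \<in> {c..v}" "K \<subseteq> \<gamma> x" "Inf K = c" "Sup K = v"
          using intv by metis
        show "norm (measure lborel K *\<^sub>R f x - (u (Sup K) - u (Inf K)))
          \<le> e * (Sup K - Inf K) + (if x \<in> N then \<bar>u (Sup K) - u (Inf K)\<bar> else 0)"
        proof (cases "x \<in> N")
          case True
          then show ?thesis
            using K mult_nonneg_nonneg[of e "v - c"] e(1) by (simp add: f_def abs_minus_commute)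
        next
          case False
          have "K \<subseteq> ball x (d x)"
            using False K by (simp add: \<gamma>_def)
          moreover have "c \<in> K" "v \<in> K"
            using K by auto
          ultimately have "c \<in> ball x (d x)" "v \<in> ball x (d x)"
            by blast+
          then have "norm (c - x) < d x" "norm (v - x) < d x"
            by (auto simp: dist_real_def)
          moreover have "x \<in> {a..b} - N" "c \<in> {a..b}" "v \<in> {a..b}"
            using False K by auto
          ultimately have "norm (u c - u x - u' x * (c-x)) \<le> e * norm (c-x)"
             "norm (u v - u x - u' x * (v-x)) \<le> e * norm (v-x)"
            using d(2) by blast+
          moreover have "norm (c - x) = x - c" "norm (v - x) = v - x"
            using K by auto
          ultimately have "\<bar>u c - u x - u' x * (c-x)\<bar> \<le> e * (x - c)"
            "\<bar>u v - u x - u' x * (v-x)\<bar> \<le> e * (v - x)"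
            by simp_all
          \<comment> \<open>The linear approximations at both end points are subtracted; since the
            tag lies between them, the errors add up to \<open>e\<close> times the length of the
            cell.\<close>
          then have "\<bar>(u c - u x - u' x * (c-x)) - (u v - u x - u' x * (v-x))\<bar> \<le> e * (x - c) + e * (v - x)"
            by linarith
          then have "\<bar>(v - c) * u' x - (u v - u c)\<bar> \<le> e * (v - c)"
            by (simp add: algebra_simps)
          then show ?thesis
            using False K by (simp add: f_def)
        qed
      qed
      also have "\<dots> = e * (b - a) + (\<Sum>(x,K)\<in>q. \<bar>u (Sup K) - u (Inf K)\<bar>)"
      proof -
        have "(\<Sum>(x,K)\<in>p. if x \<in> N then \<bar>u (Sup K) - u (Inf K)\<bar> else 0)
          = (\<Sum>(x,K)\<in>q. \<bar>u (Sup K) - u (Inf K)\<bar>)"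
          unfolding q_def sum.inter_filter[OF fin(1)] by (intro sum.cong) auto
        then show ?thesis
          unfolding ba(1) sum_distrib_left by (simp add: sum.distrib case_prod_beta)
      qed
      also have "\<dots> < \<epsilon>"
        using small e(2) by simp
      finally show ?thesis .
    qed
    show "\<exists>\<gamma>. gauge \<gamma> \<and> (\<forall>\<D>. \<D> tagged_division_of {a..b} \<and> \<gamma> fine \<D> \<longrightarrow>
         norm (sum (\<lambda>(x,k). measure lborel k *\<^sub>R f x) \<D> - (u b - u a)) < \<epsilon>)"
      using gauge fine by (intro exI[of _ \<gamma>] conjI allI impI) simp_all
  qed
  then show ?thesis
    by (rule has_integral_spike[OF N, rotated]) (auto simp: f_def)
qed

lemma abs_continuous_on_subset:
  assumes "abs_continuous_on a b u" "a \<le> c" "d \<le> b"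
  shows "abs_continuous_on c d u"
  unfolding abs_continuous_on_def
proof (intro allI impI)
  fix \<epsilon> :: real
  assume "\<epsilon> > 0"
  from assms(1)[unfolded abs_continuous_on_def, THEN spec, THEN mp, OF this]
  obtain \<delta> where "\<delta> > 0" and \<delta>: "\<forall>D :: (real \<times> real) set.
        finite D \<and> (\<forall>(c, d)\<in>D. a \<le> c \<and> c < d \<and> d \<le> b) \<and>
        disjoint_family_on (\<lambda>(c, d). {c<..<d}) D \<and>
        (\<Sum>(c, d)\<in>D. d - c) < \<delta>
        \<longrightarrow> (\<Sum>(c, d)\<in>D. \<bar>u d - u c\<bar>) < \<epsilon>"
    by (elim exE conjE)
  show "\<exists>\<delta>>0. \<forall>D :: (real \<times> real) set.
        finite D \<and> (\<forall>(c', d')\<in>D. c \<le> c' \<and> c' < d' \<and> d' \<le> d) \<and>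
        disjoint_family_on (\<lambda>(c, d). {c<..<d}) D \<and>
        (\<Sum>(c, d)\<in>D. d - c) < \<delta>
        \<longrightarrow> (\<Sum>(c, d)\<in>D. \<bar>u d - u c\<bar>) < \<epsilon>"
  proof (intro exI[of _ \<delta>] conjI allI impI, fact \<open>\<delta> > 0\<close>, elim conjE)
    fix D :: "(real \<times> real) set"
    assume D: "finite D" "\<forall>(c', d')\<in>D. c \<le> c' \<and> c' < d' \<and> d' \<le> d"
      "disjoint_family_on (\<lambda>(c, d). {c<..<d}) D" "(\<Sum>(c, d)\<in>D. d - c) < \<delta>"
    have "\<forall>(c', d')\<in>D. a \<le> c' \<and> c' < d' \<and> d' \<le> b"
      using D(2) assms(2,3) by fastforce
    with D \<delta> show "(\<Sum>(c, d)\<in>D. \<bar>u d - u c\<bar>) < \<epsilon>"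
      by simp
  qed
qed

lemma abs_continuous_on_imp_continuous_on:
  assumes "abs_continuous_on a b u"
  shows "continuous_on {a..b} u"
  unfolding continuous_on_iff
proof (intro ballI allI impI)
  fix x \<epsilon> :: real
  assume x: "x \<in> {a..b}" and "\<epsilon> > 0"
  from assms(1)[unfolded abs_continuous_on_def, THEN spec, THEN mp, OF this(2)]
  obtain \<delta> where "\<delta> > 0" and \<delta>: "\<forall>D :: (real \<times> real) set.
        finite D \<and> (\<forall>(c, d)\<in>D. a \<le> c \<and> c < d \<and> d \<le> b) \<and>
        disjoint_family_on (\<lambda>(c, d). {c<..<d}) D \<and>
        (\<Sum>(c, d)\<in>D. d - c) < \<delta>
        \<longrightarrow> (\<Sum>(c, d)\<in>D. \<bar>u d - u c\<bar>) < \<epsilon>"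
    by (elim exE conjE)
  have *: "\<bar>u d - u c\<bar> < \<epsilon>" if "a \<le> c" "c < d" "d \<le> b" "d - c < \<delta>" for c d
    using \<delta>[THEN spec, of "{(c, d)}"] that by (simp add: disjoint_family_on_def)
  have "dist (u y) (u x) < \<epsilon>" if "y \<in> {a..b}" "dist y x < \<delta>" for y
    using *[of x y] *[of y x] x that \<open>\<epsilon> > 0\<close>
    by (cases x y rule: linorder_cases) (auto simp: dist_real_def abs_minus_commute)
  with \<open>\<delta> > 0\<close> show "\<exists>\<delta>>0. \<forall>y\<in>{a..b}. dist y x < \<delta> \<longrightarrow> dist (u y) (u x) < \<epsilon>"
    by blast
qed

lemma locally_abs_continuous_imp_continuous_on:
  assumes "locally_abs_continuous u"
  shows "continuous_on {0..} u"
  unfolding continuous_on_eq_continuous_within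
proof
  fix t :: real
  assume t: "t \<in> {0..}"
  then have "continuous_on {0..t + 1} u"
    using assms by (intro abs_continuous_on_imp_continuous_on) (auto simp: locally_abs_continuous_def)
  then have "continuous (at t within {0..t + 1}) u"
    using t by (auto simp: continuous_on_eq_continuous_within)
  moreover have "at t within {0..t + 1} = at t within {0..}"
    by (rule at_within_nhd[of _ "{..<t + 1}"]) (use t in auto)
  ultimately show "continuous (at t within {0..}) u"
    by simp
qed

section \<open>Stieltjes integrals and rates\<close>

text \<open>\<open>Lim\<close> is informative only once convergence is known; for a monotone
  function the limit from the right exists as the infimum of the later values.\<close>

lemma Lim_at_right_mono:
  fixes F :: "real \<Rightarrow> real"
  assumes "mono F"
  shows "(F \<longlongrightarrow> Lim (at_right s) F) (at_right s)"
proof -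
  have "(F \<longlongrightarrow> Inf (F ` ({s<..} \<inter> UNIV))) (at s within ({s<..} \<inter> UNIV))"
    using assms by (intro Lim_right_bound[where K = "F s"]) (auto simp: monoD)
  then show ?thesis
    using tendsto_Lim[OF trivial_limit_at_right_real] by fastforce
qed

lemma Lim_at_right_bounds:
  fixes F :: "real \<Rightarrow> real"
  assumes "mono F"
  shows "F s \<le> Lim (at_right s) F" and "s < u \<Longrightarrow> Lim (at_right s) F \<le> F u"
proof -
  show "F s \<le> Lim (at_right s) F"
    using assms by (intro tendsto_lowerbound[OF Lim_at_right_mono[OF assms]])
      (auto simp: eventually_at_right_field monoD intro!: exI[of _ "s + 1"])
  show "Lim (at_right s) F \<le> F u" if "s < u"
    using assms that by (intro tendsto_upperbound[OF Lim_at_right_mono[OF assms]])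
      (auto simp: eventually_at_right_field monoD intro!: exI[of _ u])
qed

lemma mono_right_limit:
  fixes F :: "real \<Rightarrow> real"
  assumes "mono F" "s \<le> t"
  shows "Lim (at_right s) F \<le> Lim (at_right t) F"
  using Lim_at_right_bounds(2)[OF assms(1), of s t] Lim_at_right_bounds(1)[OF assms(1), of t] assms(2)
  by (cases "s = t") auto

text \<open>Right continuity is what \<open>interval_measure\<close> expects. Near \<open>s\<close>,
  the right limit at \<open>v\<close> is at most the value of \<open>F\<close> at a point further
  right, here the midpoint of \<open>v\<close> and \<open>u\<close>.\<close>

lemma continuous_right_limit:
  fixes F :: "real \<Rightarrow> real"
  assumes F: "mono F"
  shows "continuous (at_right s) (\<lambda>u. Lim (at_right u) F)"
  unfolding continuous_within
proof (rule tendstoI)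
  fix e :: real
  assume "e > 0"
  have "\<exists>u>s. \<forall>v. s < v \<and> v < u \<longrightarrow> F v < Lim (at_right s) F + e"
    using tendstoD[OF Lim_at_right_mono[OF F, of s] \<open>e > 0\<close>]
    by (force simp: eventually_at_right_field dist_real_def abs_less_iff)
  then obtain u where u: "u > s" "\<And>v. s < v \<Longrightarrow> v < u \<Longrightarrow> F v < Lim (at_right s) F + e"
    by blast
  have "dist (Lim (at_right v) F) (Lim (at_right s) F) < e" if "s < v" "v < u" for v
  proof -
    have "Lim (at_right v) F \<le> F ((v + u) / 2)"
      using Lim_at_right_bounds(2)[OF F, of v "(v + u) / 2"] that by simp
    also have "\<dots> < Lim (at_right s) F + e"
      using that by (intro u) auto
    finally show ?thesis
      using mono_right_limit[OF F, of s v] that by (simp add: dist_real_def)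
  qed
  then show "\<forall>\<^sub>F v in at_right s. dist (Lim (at_right v) F) (Lim (at_right s) F) < e"
    using u(1) by (auto simp: eventually_at_right_field)
qed

text \<open>Increments of the right limits give the mass of half-open intervals
  \<open>(s, b]\<close>; with \<open>s = a\<close> an atom at \<open>a\<close> would be lost. The
  right limits vanish to the left of \<open>a\<close>, so \<open>(s, b]\<close> has mass 1 for each
  \<open>s < a\<close>, and \<open>[a, b]\<close> is a decreasing intersection of such
  intervals.\<close>

lemma emeasure_left_stieltjes_Icc:
  assumes F: "mono F" and ab: "a \<le> b" and F0: "\<And>s. s \<le> a \<Longrightarrow> F s = 0"
    and F1: "(F \<longlongrightarrow> 1) (at_right b)"
  shows "emeasure (left_stieltjes_measure F) {a..b} = 1"
proof -
  define L where "L = (\<lambda>s. Lim (at_right s) F)"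
  have L0: "L s = 0" if "s < a" for s
    using Lim_at_right_bounds(1)[OF F, of s] Lim_at_right_bounds(2)[OF F that] F0 that
    by (simp add: L_def)
  have L1: "L b = 1"
    unfolding L_def by (intro tendsto_Lim F1) simp
  have Ioc: "emeasure (left_stieltjes_measure F) {s<..b} = 1" if "s < a" for s
    unfolding left_stieltjes_measure_def L_def[symmetric]
    using that ab L0[OF that] L1
    by (subst emeasure_interval_measure_Ioc)
       (auto simp: L_def intro: mono_right_limit[OF F] continuous_right_limit[OF F])
  define A where "A = (\<lambda>n. {a - inverse (real (Suc n))<..b})"
  have "decseq A"
    unfolding decseq_def A_def
  proof (intro allI impI)
    fix m n :: nat
    assume "m \<le> n"
    then have "a - inverse (real (Suc m)) \<le> a - inverse (real (Suc n))"
      by (intro diff_left_mono le_imp_inverse_le) auto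
    then show "{a - inverse (real (Suc n))<..b} \<subseteq> {a - inverse (real (Suc m))<..b}"
      by (meson greaterThanAtMost_iff le_less_trans subsetI)
  qed
  have A1: "emeasure (left_stieltjes_measure F) (A n) = 1" for n
    unfolding A_def by (rule Ioc) simp
  have "(\<lambda>n. emeasure (left_stieltjes_measure F) (A n)) \<longlonglongrightarrow> emeasure (left_stieltjes_measure F) (\<Inter>n. A n)"
    using \<open>decseq A\<close> by (intro Lim_emeasure_decseq) (auto simp: A1, auto simp: A_def left_stieltjes_measure_def)
  then have "emeasure (left_stieltjes_measure F) (\<Inter>n. A n) = 1"
    unfolding A1 by (rule LIMSEQ_unique[OF _ tendsto_const])
  moreover have "(\<Inter>n. A n) = {a..b}"
  proof (rule set_eqI, rule iffI)
    fix s
    assume s: "s \<in> (\<Inter>n. A n)"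
    have "\<not> s < a"
    proof
      assume "s < a"
      then obtain n where "inverse (real (Suc n)) < a - s"
        using reals_Archimedean[of "a - s"] by auto
      moreover have "s \<in> A n"
        using s by blast
      ultimately show False
        by (simp add: A_def)
    qed
    moreover have "s \<in> A 0"
      using s by blast
    ultimately show "s \<in> {a..b}"
      by (simp add: A_def)
  next
    fix s
    assume "s \<in> {a..b}"
    then show "s \<in> (\<Inter>n. A n)"
      by (auto simp: A_def intro: less_le_trans[of _ a])
  qed
  ultimately show ?thesis
    by simp
qed

text \<open>The kernel induces a probability measure on \<open>[h t, t]\<close>, and an average lies
  between any bounds of the averaged function; continuity of \<open>g\<close> supplies
  measurability.\<close>

lemma stieltjes_integral_bounds:
  assumes R: "admissible_kernel h R" and t: "0 \<le> t" "h t \<le> t"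
    and g: "continuous_on {h t..t} g" and bd: "\<And>s. h t \<le> s \<Longrightarrow> s \<le> t \<Longrightarrow> a \<le> g s \<and> g s \<le> b"
  shows "stieltjes_integral (R t) (h t) t g \<in> {a..b}"
proof -
  define M where "M = left_stieltjes_measure (R t)"
  have sets: "sets M = sets borel" "space M = UNIV"
    by (simp_all add: M_def left_stieltjes_measure_def)
  have mass: "emeasure M {h t..t} = 1"
    unfolding M_def using R t
    by (intro emeasure_left_stieltjes_Icc) (auto simp: admissible_kernel_def)
  have meas: "{h t..t} \<in> sets M"
    by (simp add: sets)
  have int: "set_integrable M {h t..t} g"
    unfolding set_integrable_def
  proof (rule integrableI_bounded_set[where A = "{h t..t}" and B = "max \<bar>a\<bar> \<bar>b\<bar>"])
    show "(\<lambda>x. indicat_real {h t..t} x *\<^sub>R g x) \<in> borel_measurable M"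
      unfolding measurable_cong_sets[OF sets(1) refl]
      by (intro borel_measurable_continuous_on_indicator g) simp
    show "AE s in M. s \<in> {h t..t} \<longrightarrow> norm (indicat_real {h t..t} s *\<^sub>R g s) \<le> max \<bar>a\<bar> \<bar>b\<bar>"
      using bd by (intro AE_I2) (auto simp: abs_le_iff le_max_iff_disj, (smt (verit))+)
  qed (use mass meas in auto)
  have const: "set_integrable M {h t..t} (\<lambda>_. c)" "(LINT s:{h t..t}|M. c) = c" for c :: real
    using mass meas by (auto simp: set_integrable_def set_lebesgue_integral_def measure_def)
  have "(LINT s:{h t..t}|M. a) \<le> (LINT s:{h t..t}|M. g s)"
    "(LINT s:{h t..t}|M. g s) \<le> (LINT s:{h t..t}|M. b)"
    using bd by (auto intro!: set_integral_mono const int)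
  then show ?thesis
    unfolding const(2) by (simp add: stieltjes_integral_def M_def)
qed

text \<open>Essential boundedness allows \<open>r\<close> to be clamped to \<open>[-C, C]\<close> at
  the cost of a null set; the clamped function is measurable and bounded.\<close>

lemma admissible_rate_integrable:
  assumes "admissible_rate r" "0 \<le> a"
  shows "r integrable_on {a..b}"
proof -
  from assms obtain C where r: "r \<in> borel_measurable (lebesgue_on {0..})"
    "AE t in lebesgue_on {0..}. \<bar>r t\<bar> \<le> C"
    by (auto simp: admissible_rate_def)
  from r(2) have "AE t in lebesgue. t \<in> {0..} \<longrightarrow> \<bar>r t\<bar> \<le> C"
    by (subst (asm) AE_restrict_space_iff) auto
  then obtain N where N: "N \<in> null_sets lebesgue" "{t. \<not> (t \<in> {0..} \<longrightarrow> \<bar>r t\<bar> \<le> C)} \<subseteq> N"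
    by (auto simp: eventually_ae_filter)
  have "negligible N"
    using N by (simp add: negligible_iff_null_sets)
  define r' where "r' = (\<lambda>t. max (- C) (min C (r t)))"
  have "r' integrable_on {a..b}"
  proof (rule measurable_bounded_by_integrable_imp_integrable_real)
    have "r \<in> borel_measurable (lebesgue_on {a..b})"
      using r(1) by (rule measurable_restrict_mono) (use assms in auto)
    then show "r' \<in> borel_measurable (lebesgue_on {a..b})"
      unfolding r'_def by measurable
    show "(\<lambda>_. \<bar>C\<bar>) integrable_on {a..b}"
      by (rule integrable_const_ivl)
  qed (auto simp: r'_def)
  then show ?thesis
  proof (rule integrable_spike[OF _ \<open>negligible N\<close>])
    fix t
    assume t: "t \<in> {a..b} - N"
    then have "t \<notin> {t. \<not> (t \<in> {0..} \<longrightarrow> \<bar>r t\<bar> \<le> C)}"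
      using N(2) by blast
    then have "\<bar>r t\<bar> \<le> C"
      using t assms(2) by simp
    then show "r t = r' t"
      by (simp add: r'_def abs_le_iff)
  qed
qed

text \<open>Monotone convergence: if the integrals over all \<open>[0, n]\<close> were at most
  \<open>B\<close>, so would be the Lebesgue integral over the half-line, which is infinite.\<close>

lemma admissible_rate_integral_unbounded:
  assumes r: "admissible_rate r"
  shows "\<exists>T\<ge>0. integral {0..T} r > B"
proof (rule ccontr)
  assume "\<not> ?thesis"
  then have B: "integral {0..T} r \<le> B" if "T \<ge> 0" for T
    using that by (auto simp: not_less)
  define f where "f = (\<lambda>(n::nat) t. ennreal (r t) * indicator {0..real n} t)"
  have meas: "f n \<in> borel_measurable lebesgue" for n
  proof -
    have "r \<in> borel_measurable (lebesgue_on {0..real n})"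
      by (rule measurable_restrict_mono[of r lebesgue "{0..}"]) (use r in \<open>auto simp: admissible_rate_def\<close>)
    then have "(\<lambda>t. ennreal (r t)) \<in> borel_measurable (lebesgue_on {0..real n})"
      by measurable
    then show ?thesis
      unfolding f_def by (subst (asm) borel_measurable_restrict_space_iff_ennreal) (auto simp: mult_ac)
  qed
  have "incseq f"
    by (auto simp: incseq_def f_def le_fun_def indicator_def)
  have fin: "integral\<^sup>N lebesgue (f n) \<le> ennreal B" for n
  proof -
    have "integral\<^sup>N lebesgue (f n) = integral\<^sup>N lborel (f n)"
      by (simp add: nn_integral_completion)
    also have "\<dots> = ennreal (integral {0..real n} r)"
      unfolding f_def using r admissible_rate_integrable[OF r, of 0 "real n"]
      by (intro nn_integral_has_integral_lebesgue') (auto simp: admissible_rate_def)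
    also have "\<dots> \<le> ennreal B"
      by (intro ennreal_leI B) simp
    finally show ?thesis .
  qed
  have "(SUP n. f n t) = ennreal (r t) * indicator {0..} t" for t
  proof (cases "0 \<le> t")
    case True
    obtain m where m: "t \<le> real m"
      using real_arch_simple by blast
    show ?thesis
    proof (rule antisym)
      show "(SUP n. f n t) \<le> ennreal (r t) * indicator {0..} t"
        using True by (intro SUP_least) (auto simp: f_def indicator_def)
      show "ennreal (r t) * indicator {0..} t \<le> (SUP n. f n t)"
        using True m by (intro SUP_upper2[of m]) (auto simp: f_def)
    qed
  qed (simp add: f_def)
  then have "(\<integral>\<^sup>+ t. ennreal (r t) * indicator {0..} t \<partial>lebesgue) = (SUP n. integral\<^sup>N lebesgue (f n))"
    using nn_integral_monotone_convergence_SUP[OF \<open>incseq f\<close> meas] by simp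
  also have "\<dots> \<le> ennreal B"
    using fin by (intro SUP_least) auto
  finally have "(\<integral>\<^sup>+ t. ennreal (r t) \<partial>lebesgue_on {0..}) \<le> ennreal B"
    by (subst nn_integral_restrict_space) auto
  then show False
    using r by (simp add: admissible_rate_def top_unique)
qed

section \<open>Relaxation towards an input\<close>

text \<open>Integrated form of \<open>u' = w (I - u)\<close>.\<close>

definition relaxes :: "(real \<Rightarrow> real) \<Rightarrow> (real \<Rightarrow> real) \<Rightarrow> (real \<Rightarrow> real) \<Rightarrow> bool" where
  "relaxes w I u \<longleftrightarrow>
     continuous_on {0..} u \<and>
     (\<forall>s t. 0 \<le> s \<longrightarrow> s \<le> t \<longrightarrow> ((\<lambda>\<tau>. w \<tau> * (I \<tau> - u \<tau>)) has_integral (u t - u s)) {s..t})"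

lemma relaxes_continuous: "relaxes w I u \<Longrightarrow> continuous_on {0..} u"
  by (simp add: relaxes_def)

lemma relaxes_has_integral:
  "relaxes w I u \<Longrightarrow> 0 \<le> s \<Longrightarrow> s \<le> t \<Longrightarrow>
    ((\<lambda>\<tau>. w \<tau> * (I \<tau> - u \<tau>)) has_integral (u t - u s)) {s..t}"
  by (simp add: relaxes_def)

text \<open>This symmetry gives \<open>relaxes_lower\<close> and
  \<open>relaxes_eventually_ge\<close> from the upper estimates.\<close>

lemma relaxes_uminus:
  assumes "relaxes w I u"
  shows "relaxes w (\<lambda>t. - I t) (\<lambda>t. - u t)"
  unfolding relaxes_def
proof (intro conjI allI impI)
  show "continuous_on {0..} (\<lambda>t. - u t)"
    using relaxes_continuous[OF assms] by (rule continuous_on_minus)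
  fix s t :: real
  assume "0 \<le> s" "s \<le> t"
  from has_integral_neg[OF relaxes_has_integral[OF assms this]]
  show "((\<lambda>\<tau>. w \<tau> * (- I \<tau> - - u \<tau>)) has_integral - u t - - u s) {s..t}"
    by (simp add: algebra_simps)
qed

text \<open>After the last time \<open>\<sigma>\<close> at which \<open>u\<close> is at most the
  claimed bound, \<open>u\<close> exceeds the input, so the integrand is nonpositive and
  \<open>u\<close> cannot have risen.\<close>

lemma relaxes_upper:
  assumes u: "relaxes w I u" and st: "0 \<le> s" "s \<le> t"
    and w: "\<And>\<tau>. s \<le> \<tau> \<Longrightarrow> \<tau> \<le> t \<Longrightarrow> 0 \<le> w \<tau>"
    and I: "\<And>\<tau>. s \<le> \<tau> \<Longrightarrow> \<tau> \<le> t \<Longrightarrow> I \<tau> \<le> c"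
  shows "u t \<le> max (u s) c"
proof (rule ccontr)
  define m where "m = max (u s) c"
  assume "\<not> u t \<le> max (u s) c"
  then have ut: "m < u t"
    unfolding m_def by linarith
  have cont: "continuous_on {s..t} u"
    using relaxes_continuous[OF u] st by (auto intro: continuous_on_subset)
  define S where "S = {s..t} \<inter> u -` {..m}"
  have "closed S"
    unfolding S_def by (rule continuous_closed_preimage[OF cont]) auto
  moreover have "s \<in> S" "bdd_above S"
    using st by (auto simp: S_def m_def)
  ultimately have "Sup S \<in> S"
    by (intro closed_contains_Sup) auto
  define \<sigma> where "\<sigma> = Sup S"
  have \<sigma>: "s \<le> \<sigma>" "\<sigma> \<le> t" "u \<sigma> \<le> m"
    using \<open>Sup S \<in> S\<close> by (auto simp: \<sigma>_def S_def)
  have above: "m < u \<tau>" if "\<sigma> < \<tau>" "\<tau> \<le> t" for \<tau>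
  proof (rule ccontr)
    assume "\<not> m < u \<tau>"
    then have "\<tau> \<in> S"
      using that \<sigma> by (simp add: S_def)
    then have "\<tau> \<le> \<sigma>"
      unfolding \<sigma>_def using \<open>bdd_above S\<close> by (rule cSup_upper)
    with that show False
      by simp
  qed
  have "u t - u \<sigma> \<le> 0"
  proof (rule has_integral_le)
    \<comment> \<open>At \<open>\<sigma>\<close> itself \<open>u\<close> need not exceed the input;
      changing the integrand at this one point secures the sign.\<close>
    show "((\<lambda>\<tau>. if \<tau> = \<sigma> then 0 else w \<tau> * (I \<tau> - u \<tau>)) has_integral (u t - u \<sigma>)) {\<sigma>..t}"
      by (rule has_integral_spike[OF negligible_sing[of \<sigma>] _ relaxes_has_integral[OF u]]) (use st \<sigma> in auto)
    show "((\<lambda>_. 0) has_integral 0) {\<sigma>..t}"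
      by simp
    fix \<tau>
    assume \<tau>: "\<tau> \<in> {\<sigma>..t}"
    show "(if \<tau> = \<sigma> then 0 else w \<tau> * (I \<tau> - u \<tau>)) \<le> 0"
    proof (cases "\<tau> = \<sigma>")
      case False
      then have "I \<tau> \<le> c" "m < u \<tau>" "0 \<le> w \<tau>"
        using \<tau> \<sigma> above[of \<tau>] by (auto intro: I w)
      then show ?thesis
        by (simp add: m_def mult_le_0_iff)
    qed simp
  qed
  with ut \<sigma> show False
    by simp
qed

lemma relaxes_lower:
  assumes "relaxes w I u" "0 \<le> s" "s \<le> t"
    and "\<And>\<tau>. s \<le> \<tau> \<Longrightarrow> \<tau> \<le> t \<Longrightarrow> 0 \<le> w \<tau>"
    and "\<And>\<tau>. s \<le> \<tau> \<Longrightarrow> \<tau> \<le> t \<Longrightarrow> c \<le> I \<tau>"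
  shows "min (u s) c \<le> u t"
  using relaxes_upper[OF relaxes_uminus[OF assms(1)], of s t "- c"] assms by (simp add: min_def max_def split: if_splits)

text \<open>While \<open>u\<close> exceeds \<open>c + \<epsilon>\<close> it decreases at least at
  the rate \<open>m * \<epsilon> * r\<close>, whose integral diverges, so \<open>u\<close> would
  drop below its eventual lower bound \<open>b\<close>. Once \<open>u\<close> is at most
  \<open>c + \<epsilon>\<close>, \<open>relaxes_upper\<close> keeps it there.\<close>

lemma relaxes_eventually_le:
  assumes u: "relaxes w I u" and r: "admissible_rate r"
    and m: "m > 0" "\<forall>\<^sub>F t in at_top. m * r t \<le> w t"
    and I: "\<forall>\<^sub>F t in at_top. I t \<le> c"
    and bound: "\<forall>\<^sub>F t in at_top. b \<le> u t" and "\<epsilon> > 0"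
  shows "\<forall>\<^sub>F t in at_top. u t \<le> c + \<epsilon>"
proof -
  have rint: "r integrable_on {0..T}" for T
    using admissible_rate_integrable[OF r] by simp
  have r0: "0 \<le> r t" if "0 \<le> t" for t
    using r that by (simp add: admissible_rate_def)
  have "\<forall>\<^sub>F t in at_top. 0 \<le> t \<and> m * r t \<le> w t \<and> I t \<le> c \<and> b \<le> u t"
    using eventually_ge_at_top[of "0::real"] m(2) I bound by eventually_elim simp
  then obtain T where T: "0 \<le> T" "\<And>t. t \<ge> T \<Longrightarrow> m * r t \<le> w t \<and> I t \<le> c \<and> b \<le> u t"
    by (auto simp: eventually_at_top_linorder)
  have w0: "0 \<le> w t" if "t \<ge> T" for t
    using T(2)[OF that] r0[of t] T(1) m(1) that by (smt (verit) mult_nonneg_nonneg)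
  have "\<exists>s\<ge>T. u s \<le> c + \<epsilon>"
  proof (rule ccontr)
    assume "\<not> ?thesis"
    then have big: "c + \<epsilon> < u s" if "s \<ge> T" for s
      using that by (meson not_le)
    \<comment> \<open>The first term of \<open>B\<close> forces \<open>t\<close> beyond
      \<open>T\<close>; the second is the amount of integrated rate after \<open>T\<close> that
      takes \<open>u\<close> from \<open>u T\<close> down to \<open>b\<close>.\<close>
    define B where "B = integral {0..T} r + (u T - b) / (m * \<epsilon>)"
    obtain t where t: "0 \<le> t" "B < integral {0..t} r"
      using admissible_rate_integral_unbounded[OF r, of B] by blast
    have "T \<le> t"
    proof (rule ccontr)
      assume "\<not> T \<le> t"
      then have "integral {0..t} r \<le> integral {0..T} r"
        using t by (intro integral_subset_le rint) (auto intro: r0)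
      moreover have "0 \<le> (u T - b) / (m * \<epsilon>)"
        using T(2)[of T] m \<open>\<epsilon> > 0\<close> by simp
      ultimately show False
        using t by (simp add: B_def)
    qed
    have rT: "r integrable_on {T..t}"
      by (rule integrable_subinterval_real[OF rint[of t]]) (use T in auto)
    have "u t - u T \<le> - (m * \<epsilon>) * integral {T..t} r"
    proof (rule has_integral_le)
      show "((\<lambda>\<tau>. w \<tau> * (I \<tau> - u \<tau>)) has_integral (u t - u T)) {T..t}"
        by (rule relaxes_has_integral[OF u T(1) \<open>T \<le> t\<close>])
      show "((\<lambda>\<tau>. - (m * \<epsilon>) * r \<tau>) has_integral - (m * \<epsilon>) * integral {T..t} r) {T..t}"
        by (intro has_integral_mult_right integrable_integral rT)
      fix \<tau>
      assume "\<tau> \<in> {T..t}"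
      then have "m * r \<tau> \<le> w \<tau>" "I \<tau> - u \<tau> \<le> - \<epsilon>" "0 \<le> w \<tau>"
        using T(2)[of \<tau>] big[of \<tau>] w0 by auto
      then have "w \<tau> * (I \<tau> - u \<tau>) \<le> w \<tau> * (- \<epsilon>)" "w \<tau> * \<epsilon> \<ge> m * r \<tau> * \<epsilon>"
        using \<open>\<epsilon> > 0\<close> mult_left_mono[of "I \<tau> - u \<tau>" "- \<epsilon>" "w \<tau>"] by (auto intro: mult_right_mono)
      then show "w \<tau> * (I \<tau> - u \<tau>) \<le> - (m * \<epsilon>) * r \<tau>"
        by (simp add: mult_ac)
    qed
    moreover have "integral {0..T} r + integral {T..t} r = integral {0..t} r"
      by (rule Henstock_Kurzweil_Integration.integral_combine[OF T(1) \<open>T \<le> t\<close> rint])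
    then have "(u T - b) / (m * \<epsilon>) < integral {T..t} r"
      using t by (simp add: B_def)
    then have "u T - b < m * \<epsilon> * integral {T..t} r"
      using m \<open>\<epsilon> > 0\<close> by (simp add: divide_less_eq mult_ac)
    ultimately have "u t < b"
      by simp
    with T(2)[OF \<open>T \<le> t\<close>] show False
      by simp
  qed
  then obtain s where s: "s \<ge> T" "u s \<le> c + \<epsilon>"
    by blast
  have "u t \<le> c + \<epsilon>" if "t \<ge> s" for t
  proof -
    have "u t \<le> max (u s) c"
      using u that s T by (intro relaxes_upper[OF u]) (auto intro: w0)
    with s \<open>\<epsilon> > 0\<close> show ?thesis
      by simp
  qed
  then show ?thesis
    by (auto simp: eventually_at_top_linorder)
qed

lemma relaxes_eventually_ge:
  assumes "relaxes w I u" "admissible_rate r"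
    and "m > 0" "\<forall>\<^sub>F t in at_top. m * r t \<le> w t"
    and I: "\<forall>\<^sub>F t in at_top. c \<le> I t"
    and b: "\<forall>\<^sub>F t in at_top. u t \<le> b" and "\<epsilon> > 0"
  shows "\<forall>\<^sub>F t in at_top. c - \<epsilon> \<le> u t"
proof -
  have "\<forall>\<^sub>F t in at_top. - u t \<le> - c + \<epsilon>"
    using assms by (intro relaxes_eventually_le[OF relaxes_uminus[OF assms(1)], where m = m and b = "- b"]) auto
  then show ?thesis
    by eventually_elim simp
qed

text \<open>On a short final interval \<open>u\<close> loses at most half of its maximum there.\<close>

lemma relaxes_stays_positive:
  assumes u: "relaxes w I u" and \<tau>: "0 < \<tau>"
    and pos: "\<And>s. 0 \<le> s \<Longrightarrow> s < \<tau> \<Longrightarrow> 0 < u s"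
    and I: "\<And>s. 0 \<le> s \<Longrightarrow> s \<le> \<tau> \<Longrightarrow> 0 \<le> I s"
    and r: "r integrable_on {0..\<tau>}"
    and w: "\<And>s. 0 \<le> s \<Longrightarrow> s \<le> \<tau> \<Longrightarrow> 0 \<le> w s \<and> w s \<le> C * r s"
  shows "0 < u \<tau>"
proof -
  have cont: "continuous_on {0..\<tau>} u"
    using relaxes_continuous[OF u] by (rule continuous_on_subset) auto
  have int: "(\<lambda>s. C * r s) integrable_on {0..\<tau>}"
    using r by (intro integrable_on_mult_right)
  \<comment> \<open>Short is meant with respect to the rate: \<open>s0\<close> is chosen so that
    \<open>C * r\<close> has integral below one half over \<open>[s0, \<tau>]\<close>.\<close>
  have "continuous_on {0..\<tau>} (\<lambda>s. integral {s..\<tau>} (\<lambda>s. C * r s))"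
    by (rule indefinite_integral_continuous_1'[OF int])
  then have "((\<lambda>s. integral {s..\<tau>} (\<lambda>s. C * r s)) \<longlongrightarrow> integral {\<tau>..\<tau>} (\<lambda>s. C * r s)) (at \<tau> within {0..\<tau>})"
    using \<tau> unfolding continuous_on_def by (meson atLeastAtMost_iff less_imp_le order_refl)
  then have "((\<lambda>s. integral {s..\<tau>} (\<lambda>s. C * r s)) \<longlongrightarrow> 0) (at \<tau> within {0..\<tau>})"
    by simp
  then have "\<forall>\<^sub>F s in at \<tau> within {0..\<tau>}. integral {s..\<tau>} (\<lambda>s. C * r s) < 1 / 2"
    by (rule order_tendstoD) simp
  moreover have "\<forall>\<^sub>F s in at \<tau> within {0..\<tau>}. s \<in> {0..<\<tau>}"
    by (auto simp: eventually_at_filter)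
  ultimately have "\<forall>\<^sub>F s in at \<tau> within {0..\<tau>}. integral {s..\<tau>} (\<lambda>s. C * r s) < 1 / 2 \<and> s \<in> {0..<\<tau>}"
    by (rule eventually_conj)
  moreover have "at \<tau> within {0..\<tau>} \<noteq> bot"
    using \<tau> by (simp add: at_within_Icc_at_left)
  ultimately obtain s0 where s0: "0 \<le> s0" "s0 < \<tau>" "integral {s0..\<tau>} (\<lambda>s. C * r s) < 1 / 2"
    using eventually_happens' by fastforce
  \<comment> \<open>From a maximum point \<open>s\<close> on, \<open>u\<close> decreases at most at
    the rate \<open>C * r\<close> times the fixed number \<open>u s\<close>.\<close>
  have "\<exists>s\<in>{s0..\<tau>}. \<forall>t\<in>{s0..\<tau>}. u t \<le> u s"
    using s0 cont by (intro continuous_attains_sup) (auto intro: continuous_on_subset)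
  then obtain s where s: "s0 \<le> s" "s \<le> \<tau>" "\<And>t. s0 \<le> t \<Longrightarrow> t \<le> \<tau> \<Longrightarrow> u t \<le> u s"
    by auto
  have us: "0 < u s"
    using pos[of s0] s(3)[of s0] s0 by simp
  have int_s: "(\<lambda>s. C * r s) integrable_on {s..\<tau>}"
    by (rule integrable_subinterval_real[OF int]) (use s s0 in auto)
  have "- (u s) * integral {s..\<tau>} (\<lambda>s. C * r s) \<le> u \<tau> - u s"
  proof (rule has_integral_le)
    show "((\<lambda>t. - (u s) * (C * r t)) has_integral - (u s) * integral {s..\<tau>} (\<lambda>s. C * r s)) {s..\<tau>}"
      by (intro has_integral_mult_right integrable_integral int_s)
    show "((\<lambda>\<tau>. w \<tau> * (I \<tau> - u \<tau>)) has_integral (u \<tau> - u s)) {s..\<tau>}"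
      using s s0 by (intro relaxes_has_integral[OF u]) auto
    fix t
    assume t: "t \<in> {s..\<tau>}"
    then have "u t \<le> u s" "0 \<le> I t"
      using s s0 by (auto intro: I)
    then have "- u s \<le> I t - u t"
      by simp
    moreover have "0 \<le> w t" "w t \<le> C * r t"
      using w[of t] t s s0 by auto
    ultimately have "w t * (- u s) \<le> w t * (I t - u t)" "w t * u s \<le> C * r t * u s"
      using us by (blast intro: mult_left_mono mult_right_mono less_imp_le)+
    then show "- u s * (C * r t) \<le> w t * (I t - u t)"
      by (simp add: mult_ac)
  qed
  moreover have "integral {s..\<tau>} (\<lambda>s. C * r s) \<le> integral {s0..\<tau>} (\<lambda>s. C * r s)"
  proof (rule integral_subset_le[OF _ int_s])
    show "(\<lambda>s. C * r s) integrable_on {s0..\<tau>}"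
      by (rule integrable_subinterval_real[OF int]) (use s0 in auto)
    show "\<forall>t\<in>{s0..\<tau>}. 0 \<le> C * r t"
      using w s0 by (meson atLeastAtMost_iff order_trans less_imp_le)
  qed (use s in auto)
  then have "u s * integral {s..\<tau>} (\<lambda>s. C * r s) < u s * 1"
    using s0 us by (intro mult_strict_left_mono) auto
  ultimately show ?thesis
    by simp
qed

text \<open>At the first time \<open>\<tau>\<close> where \<open>p\<close> is not positive, all
  earlier values are positive and continuity gives \<open>p \<tau> \<ge> 0\<close>, so
  \<open>step\<close> applies and contradicts the choice of \<open>\<tau>\<close>. Two coupled
  functions are handled by taking \<open>p\<close> to be their minimum.\<close>

lemma continuous_positive_continuation:
  fixes p :: "real \<Rightarrow> real"
  assumes p: "continuous_on {T..} p" "p T > 0"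
    and step: "\<And>\<tau>. T < \<tau> \<Longrightarrow> (\<And>s. T \<le> s \<Longrightarrow> s < \<tau> \<Longrightarrow> p s > 0) \<Longrightarrow> p \<tau> \<ge> 0 \<Longrightarrow> p \<tau> > 0"
    and t: "T \<le> t"
  shows "p t > 0"
proof (rule ccontr)
  assume "\<not> p t > 0"
  define S where "S = {T..} \<inter> p -` {..0}"
  have "closed S"
    unfolding S_def by (rule continuous_closed_preimage[OF p(1)]) auto
  moreover have S: "t \<in> S" "bdd_below S"
    using t \<open>\<not> p t > 0\<close> by (auto simp: S_def bdd_below_def)
  ultimately have "Inf S \<in> S"
    by (intro closed_contains_Inf) auto
  define \<tau> where "\<tau> = Inf S"
  have \<tau>: "T \<le> \<tau>" "p \<tau> \<le> 0"
    using \<open>Inf S \<in> S\<close> by (auto simp: \<tau>_def S_def)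
  have before: "p s > 0" if "T \<le> s" "s < \<tau>" for s
  proof (rule ccontr)
    assume "\<not> p s > 0"
    then have "\<tau> \<le> s"
      unfolding \<tau>_def using that S by (intro cInf_lower) (auto simp: S_def)
    with that show False
      by simp
  qed
  have "T < \<tau>"
    using \<tau> p(2) by (cases "T = \<tau>") auto
  have "p \<tau> \<ge> 0"
  proof (rule tendsto_lowerbound)
    show "(p \<longlongrightarrow> p \<tau>) (at \<tau> within {T..\<tau>})"
      using continuous_on_subset[OF p(1), of "{T..\<tau>}"] \<tau> by (auto simp: continuous_on_def)
    show "\<forall>\<^sub>F s in at \<tau> within {T..\<tau>}. 0 \<le> p s"
      using before by (auto simp: eventually_at_filter intro!: always_eventually less_imp_le)
    show "at \<tau> within {T..\<tau>} \<noteq> bot"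
      using \<open>T < \<tau>\<close> by (simp add: at_within_Icc_at_left)
  qed
  with step[OF \<open>T < \<tau>\<close> before] \<tau> show False
    by simp
qed

text \<open>Let \<open>L\<close> be the infimum of the eventual upper bounds in
  \<open>[K, A]\<close>. If \<open>L > K\<close>, then \<open>g L < L\<close>, and by continuity one
  more \<open>step\<close> from a bound close to \<open>L\<close> ends strictly below
  \<open>L\<close>.\<close>

lemma eventually_le_fixed_point:
  fixes g u :: "real \<Rightarrow> real"
  assumes KA: "K \<le> A" and g: "continuous_on {K..A} g" "\<And>a. K < a \<Longrightarrow> a \<le> A \<Longrightarrow> g a < a"
    and A: "\<forall>\<^sub>F t in at_top. u t \<le> A"
    and step: "\<And>a \<epsilon>. K \<le> a \<Longrightarrow> a \<le> A \<Longrightarrow> \<forall>\<^sub>F t in at_top. u t \<le> a \<Longrightarrow> \<epsilon> > 0 \<Longrightarrow>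
        \<forall>\<^sub>F t in at_top. u t \<le> g a + \<epsilon>"
    and "\<epsilon> > 0"
  shows "\<forall>\<^sub>F t in at_top. u t \<le> K + \<epsilon>"
proof -
  define S where "S = {a \<in> {K..A}. \<forall>\<^sub>F t in at_top. u t \<le> a}"
  define L where "L = Inf S"
  have S: "A \<in> S" "bdd_below S"
    using KA A by (auto simp: S_def bdd_below_def)
  have L: "K \<le> L" "L \<le> A"
    unfolding L_def using S by (auto intro!: cInf_greatest cInf_lower simp: S_def)
  have near: "\<exists>a\<in>S. a < L + e" if "e > 0" for e
    using cInf_lessD[of S "L + e"] S that by (auto simp: L_def)
  have "L = K"
  proof (rule ccontr)
    assume "L \<noteq> K"
    then have "K < L"
      using L by simp
    \<comment> \<open>A third of the gap each for the continuity error and the error of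
      \<open>step\<close>; the last third keeps the new bound strictly below
      \<open>L\<close>.\<close>
    define e where "e = (L - g L) / 3"
    have "e > 0"
      using g(2)[OF \<open>K < L\<close>] L by (simp add: e_def)
    obtain d where d: "d > 0" "\<And>a. a \<in> {K..A} \<Longrightarrow> dist a L < d \<Longrightarrow> dist (g a) (g L) < e"
      using g(1) L \<open>e > 0\<close> unfolding continuous_on_iff by (metis atLeastAtMost_iff)
    obtain a where a: "a \<in> S" "a < L + d"
      using near[OF d(1)] by blast
    then have "L \<le> a"
      unfolding L_def using S by (auto intro: cInf_lower)
    then have "g a < g L + e"
      using d(2)[of a] a by (simp add: S_def dist_real_def abs_less_iff)
    then have ga: "g a + e < L"
      using g(2)[OF \<open>K < L\<close>] L by (simp add: e_def field_simps)
    have "\<forall>\<^sub>F t in at_top. u t \<le> g a + e"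
      using a \<open>e > 0\<close> by (intro step) (auto simp: S_def)
    \<comment> \<open>The maximum with \<open>K\<close> keeps the candidate in the range over which
      the infimum is taken.\<close>
    then have "\<forall>\<^sub>F t in at_top. u t \<le> max K (g a + e)"
      by eventually_elim simp
    then have "max K (g a + e) \<in> S"
      using L ga by (auto simp: S_def)
    then have "L \<le> max K (g a + e)"
      unfolding L_def using S by (auto intro: cInf_lower)
    with ga \<open>K < L\<close> show False
      by simp
  qed
  with near[OF \<open>\<epsilon> > 0\<close>] obtain a where "a \<in> S" "a < K + \<epsilon>"
    by auto
  then have "\<forall>\<^sub>F t in at_top. u t \<le> a"
    by (simp add: S_def)
  then show ?thesis
    by eventually_elim (use \<open>a < K + \<epsilon>\<close> in simp)
qed

section \<open>One equation of the system\<close>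

lemma satisfies_equation_relaxes:
  assumes ac: "locally_abs_continuous u" and eq: "satisfies_equation r G f h R u v"
  shows "relaxes (\<lambda>t. r t * G (u t)) (\<lambda>t. stieltjes_integral (R t) (h t) t (\<lambda>s. f (v s))) u"
  unfolding relaxes_def
proof (intro conjI allI impI)
  show "continuous_on {0..} u"
    by (rule locally_abs_continuous_imp_continuous_on[OF ac])
  fix s t :: real
  assume st: "0 \<le> s" "s \<le> t"
  let ?D = "\<lambda>t. r t * G (u t) * (stieltjes_integral (R t) (h t) t (\<lambda>s. f (v s)) - u t)"
  obtain N where N: "N \<in> null_sets lebesgue" "{t. \<not> (0 \<le> t \<longrightarrow> (u has_real_derivative ?D t) (at t))} \<subseteq> N"
    using eq unfolding satisfies_equation_def eventually_ae_filter by auto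
  show "(?D has_integral u t - u s) {s..t}"
  proof (rule abs_continuous_fundamental_theorem[OF st(2)])
    have "abs_continuous_on 0 (t + 1) u"
      using ac st by (auto simp: locally_abs_continuous_def)
    then show "abs_continuous_on s t u"
      by (rule abs_continuous_on_subset) (use st in auto)
    show "negligible N"
      using N by (simp add: negligible_iff_null_sets)
    fix \<tau>
    assume \<tau>: "\<tau> \<in> {s..t} - N"
    then have "\<tau> \<notin> {t. \<not> (0 \<le> t \<longrightarrow> (u has_real_derivative ?D t) (at t))}"
      using N(2) by blast
    then have "(u has_real_derivative ?D \<tau>) (at \<tau>)"
      using \<tau> st by simp
    then show "(u has_real_derivative ?D \<tau>) (at \<tau> within {s..t})"
      by (rule has_field_derivative_at_within)
  qed
qed

text \<open>The other unknown \<open>v\<close> is treated as a given function, which decouples the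
  system; the locale is interpreted for \<open>x\<close> and, with the roles exchanged, for
  \<open>y\<close>. Continuity of \<open>v\<close> is on the whole line because the delays may reach
  back to the initial data.\<close>

locale delayed_relaxation =
  fixes r G f h :: "real \<Rightarrow> real" and R :: "real \<Rightarrow> real \<Rightarrow> real" and u v :: "real \<Rightarrow> real"
  assumes f_cont: "continuous_on {0..} f" and f_mono: "strict_mono_on {0..} f" and f0: "0 \<le> f 0"
    and h: "admissible_delay h" and R: "admissible_kernel h R" and r: "admissible_rate r"
    and G_cont: "continuous_on {0..} G" and G_pos: "\<And>z. z > 0 \<Longrightarrow> G z > 0" and G0: "0 \<le> G 0"
    and ac: "locally_abs_continuous u" and eq: "satisfies_equation r G f h R u v"
    and v_cont: "continuous_on UNIV v"
begin

definition input :: "real \<Rightarrow> real" where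
  "input t = stieltjes_integral (R t) (h t) t (\<lambda>s. f (v s))"

definition weight :: "real \<Rightarrow> real" where
  "weight t = r t * G (u t)"

lemma relax: "relaxes weight input u"
  unfolding input_def weight_def by (rule satisfies_equation_relaxes[OF ac eq])

lemma u_cont: "continuous_on {0..} u"
  using relax by (rule relaxes_continuous)

lemma r_nonneg: "0 \<le> t \<Longrightarrow> 0 \<le> r t"
  using r by (simp add: admissible_rate_def)

lemma G_nonneg: "0 \<le> z \<Longrightarrow> 0 \<le> G z"
  using G0 G_pos[of z] by (cases "z = 0") auto

lemma f_le: "0 \<le> a \<Longrightarrow> a \<le> b \<Longrightarrow> f a \<le> f b"
  using f_mono by (auto simp: strict_mono_on_leD)

lemma weight_nonneg: "0 \<le> t \<Longrightarrow> 0 \<le> u t \<Longrightarrow> 0 \<le> weight t"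
  by (simp add: weight_def r_nonneg G_nonneg)

lemma input_bounds:
  assumes t: "0 \<le> t" and bd: "\<And>s. h t \<le> s \<Longrightarrow> s \<le> t \<Longrightarrow> 0 \<le> v s \<and> a \<le> f (v s) \<and> f (v s) \<le> b"
  shows "a \<le> input t \<and> input t \<le> b"
proof -
  have "continuous_on {h t..t} (f \<circ> v)"
    using bd by (intro continuous_on_compose continuous_on_subset[OF v_cont] continuous_on_subset[OF f_cont]) auto
  then have "input t \<in> {a..b}"
    unfolding input_def using t h bd
    by (intro stieltjes_integral_bounds[OF R]) (auto simp: admissible_delay_def o_def)
  then show ?thesis
    by simp
qed

lemma input_le:
  assumes "0 \<le> t" "\<And>s. h t \<le> s \<Longrightarrow> s \<le> t \<Longrightarrow> 0 \<le> v s \<and> v s \<le> \<beta>"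
  shows "input t \<le> f \<beta>"
  using assms input_bounds[of t "f 0" "f \<beta>"] by (simp add: f_le)

lemma input_ge:
  assumes t: "0 \<le> t" and \<alpha>: "0 \<le> \<alpha>" "\<And>s. h t \<le> s \<Longrightarrow> s \<le> t \<Longrightarrow> \<alpha> \<le> v s"
  shows "f \<alpha> \<le> input t"
proof -
  have ht: "h t \<le> t"
    using h t by (simp add: admissible_delay_def)
  \<comment> \<open>\<open>input_bounds\<close> asks for bounds on both sides; the upper one comes
    from the maximum of \<open>v\<close> on the compact window.\<close>
  then obtain m where "\<forall>s\<in>{h t..t}. v s \<le> v m"
    using continuous_attains_sup[of "{h t..t}" v] continuous_on_subset[OF v_cont] by auto
  then show ?thesis
    using \<alpha> input_bounds[OF t, of "f \<alpha>" "f (v m)"] by (force intro: f_le)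
qed

text \<open>\<open>G \<circ> u\<close> is bounded on \<open>[0, \<tau>]\<close>, so the weight is
  dominated by a multiple of \<open>r\<close> and \<open>relaxes_stays_positive\<close> applies. The
  weak inequality at \<open>\<tau>\<close> keeps \<open>u\<close> in the domain of
  \<open>G\<close>.\<close>

lemma stays_positive:
  assumes \<tau>: "0 < \<tau>" and u: "\<And>s. 0 \<le> s \<Longrightarrow> s < \<tau> \<Longrightarrow> 0 < u s" "0 \<le> u \<tau>"
    and v: "\<And>s. s \<le> \<tau> \<Longrightarrow> 0 \<le> v s"
  shows "0 < u \<tau>"
proof -
  have u0: "0 \<le> u s" if "0 \<le> s" "s \<le> \<tau>" for s
    using u(1)[of s] u(2) that by (cases "s = \<tau>") auto
  have "continuous_on {0..\<tau>} (G \<circ> u)"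
    using u0 by (intro continuous_on_compose continuous_on_subset[OF u_cont] continuous_on_subset[OF G_cont]) auto
  then have "\<exists>m\<in>{0..\<tau>}. \<forall>s\<in>{0..\<tau>}. (G \<circ> u) s \<le> (G \<circ> u) m"
    using \<tau> by (intro continuous_attains_sup) auto
  then obtain m where m: "\<forall>s\<in>{0..\<tau>}. G (u s) \<le> G (u m)"
    by auto
  show ?thesis
  proof (rule relaxes_stays_positive[OF relax \<tau> u(1)])
    show "0 \<le> input s" if "0 \<le> s" "s \<le> \<tau>" for s
      using input_ge[of s 0] that v f0 by force
    show "r integrable_on {0..\<tau>}"
      using admissible_rate_integrable[OF r] by simp
    show "0 \<le> weight s \<and> weight s \<le> G (u m) * r s" if "0 \<le> s" "s \<le> \<tau>" for s
      using that weight_nonneg[of s] u0[of s] m r_nonneg[of s]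
      by (auto simp: weight_def mult.commute[of "r s"] intro: mult_right_mono)
  qed
qed

text \<open>Weak bounds on \<open>v\<close> give a strict bound on \<open>u\<close>, the gain that a
  continuation argument needs: \<open>u\<close> stays below the larger of its initial value and
  \<open>f B\<close>.\<close>

lemma stays_below:
  assumes \<tau>: "0 \<le> \<tau>" and u: "\<And>s. 0 \<le> s \<Longrightarrow> s \<le> \<tau> \<Longrightarrow> 0 \<le> u s" "u 0 < A"
    and v: "\<And>s. s \<le> \<tau> \<Longrightarrow> 0 \<le> v s \<and> v s \<le> B" and AB: "f B < A"
  shows "u \<tau> < A"
proof -
  have "u \<tau> \<le> max (u 0) (f B)"
    using \<tau> u v by (intro relaxes_upper[OF relax]) (auto intro: weight_nonneg input_le)
  with u(2) AB show ?thesis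
    by simp
qed

text \<open>From \<open>T\<close> on the delays reach back only to nonnegative times, where
  \<open>v\<close> is at least \<open>\<eta>\<close>, so the input stays above
  \<open>\<delta>\<close>.\<close>

lemma stays_above:
  assumes T: "0 \<le> T" "T \<le> \<tau>" "\<And>t. t \<ge> T \<Longrightarrow> 0 \<le> h t"
    and u: "\<And>s. T \<le> s \<Longrightarrow> s \<le> \<tau> \<Longrightarrow> 0 \<le> u s" "\<delta> < u T"
    and v: "\<And>s. 0 \<le> s \<Longrightarrow> s \<le> \<tau> \<Longrightarrow> \<eta> \<le> v s" and \<eta>: "0 \<le> \<eta>" "\<delta> < f \<eta>"
  shows "\<delta> < u \<tau>"
proof -
  have "min (u T) (f \<eta>) \<le> u \<tau>"
  proof (rule relaxes_lower[OF relax T(1,2)])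
    show "f \<eta> \<le> input t" if "T \<le> t" "t \<le> \<tau>" for t
      using that T(1) T(3)[of t] \<eta> by (intro input_ge v) auto
  qed (use T u in \<open>auto intro: weight_nonneg\<close>)
  with u(2) \<eta> show ?thesis
    by simp
qed

text \<open>\<open>G\<close> has a positive minimum on the compact interval
  \<open>[\<delta>, A]\<close>; the weight thereby inherits the divergence of the integral of
  \<open>r\<close>.\<close>

lemma weight_lower_bound:
  assumes "0 < \<delta>" and u: "\<And>t. 0 \<le> t \<Longrightarrow> \<delta> \<le> u t \<and> u t \<le> A"
  shows "\<exists>m>0. \<forall>\<^sub>F t in at_top. m * r t \<le> weight t"
proof -
  have "\<delta> \<le> A"
    using u[of 0] by simp
  moreover have "continuous_on {\<delta>..A} G"
    using \<open>0 < \<delta>\<close> by (intro continuous_on_subset[OF G_cont]) auto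
  ultimately obtain z where z: "z \<in> {\<delta>..A}" "\<And>z'. z' \<in> {\<delta>..A} \<Longrightarrow> G z \<le> G z'"
    using continuous_attains_inf[of "{\<delta>..A}" G] by auto
  have "\<forall>\<^sub>F t in at_top. G z * r t \<le> weight t"
    using eventually_ge_at_top[of 0]
    by eventually_elim (use u z r_nonneg in \<open>auto simp: weight_def mult.commute[of "r _"] intro!: mult_right_mono\<close>)
  then show ?thesis
    using G_pos[of z] z(1) \<open>0 < \<delta>\<close> by auto
qed

text \<open>Because \<open>h t\<close> tends to infinity, the times from \<open>h t\<close> on
  eventually lie where \<open>P\<close> already holds.\<close>

lemma eventually_delayed:
  assumes "\<forall>\<^sub>F t in at_top. P t"
  shows "\<forall>\<^sub>F t in at_top. 0 \<le> t \<and> (\<forall>s. h t \<le> s \<longrightarrow> P s)"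
proof -
  from assms obtain T where T: "\<And>s. s \<ge> T \<Longrightarrow> P s"
    by (auto simp: eventually_at_top_linorder)
  have "\<forall>\<^sub>F t in at_top. T \<le> h t"
    using h by (auto simp: admissible_delay_def filterlim_at_top)
  then show ?thesis
    using eventually_ge_at_top[of 0] by eventually_elim (use T in auto)
qed

text \<open>A late delay window passes the bound of \<open>v\<close> to the input, and relaxation
  passes it to \<open>u\<close>, up to \<open>\<epsilon>\<close>.\<close>

lemma eventually_le:
  assumes "0 < \<delta>" and u: "\<And>t. 0 \<le> t \<Longrightarrow> \<delta> \<le> u t \<and> u t \<le> A"
    and v: "\<And>t. 0 \<le> v t" "\<forall>\<^sub>F t in at_top. v t \<le> \<beta>" and "\<epsilon> > 0"
  shows "\<forall>\<^sub>F t in at_top. u t \<le> f \<beta> + \<epsilon>"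
proof -
  obtain m where m: "m > 0" "\<forall>\<^sub>F t in at_top. m * r t \<le> weight t"
    using weight_lower_bound[OF assms(1) u] by blast
  have "\<forall>\<^sub>F t in at_top. input t \<le> f \<beta>"
    using eventually_delayed[OF v(2)] by eventually_elim (use v(1) in \<open>auto intro: input_le\<close>)
  moreover have "\<forall>\<^sub>F t in at_top. \<delta> \<le> u t"
    using eventually_ge_at_top[of 0] by eventually_elim (use u in auto)
  ultimately show ?thesis
    using \<open>\<epsilon> > 0\<close> by (intro relaxes_eventually_le[OF relax r m]) auto
qed

lemma eventually_ge:
  assumes "0 < \<delta>" and u: "\<And>t. 0 \<le> t \<Longrightarrow> \<delta> \<le> u t \<and> u t \<le> A"
    and v: "0 \<le> \<alpha>" "\<forall>\<^sub>F t in at_top. \<alpha> \<le> v t" and "\<epsilon> > 0"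
  shows "\<forall>\<^sub>F t in at_top. f \<alpha> - \<epsilon> \<le> u t"
proof -
  obtain m where m: "m > 0" "\<forall>\<^sub>F t in at_top. m * r t \<le> weight t"
    using weight_lower_bound[OF assms(1) u] by blast
  have "\<forall>\<^sub>F t in at_top. f \<alpha> \<le> input t"
    using eventually_delayed[OF v(2)] by eventually_elim (use v(1) in \<open>auto intro: input_ge\<close>)
  moreover have "\<forall>\<^sub>F t in at_top. u t \<le> A"
    using eventually_ge_at_top[of 0] by eventually_elim (use u in auto)
  ultimately show ?thesis
    using \<open>\<epsilon> > 0\<close> by (intro relaxes_eventually_ge[OF relax r m]) auto
qed

end

section \<open>Convergence\<close>

text \<open>Being below a real number, the inverse is finite, so \<open>c\<close> lies in the range
  and monotonicity applies.\<close>

lemma ext_inverse_less_imp: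
  assumes f: "strict_mono_on {0..} f" and "0 \<le> z" "f 0 \<le> c" "ext_inverse f c < ereal z"
  shows "c < f z"
proof -
  from assms have c: "c \<in> f ` {0..}"
    by (auto simp: ext_inverse_def split: if_splits)
  then obtain w where w: "w \<ge> 0" "c = f w"
    by auto
  have "the_inv_into {0..} f c = w"
    using w f by (auto intro!: the_inv_into_f_f strict_mono_on_imp_inj_on)
  with assms c have "w < z"
    by (auto simp: ext_inverse_def split: if_splits)
  with w assms show ?thesis
    by (auto intro: strict_mono_onD)
qed

text \<open>The value infinity is covered too: if \<open>f z \<ge> c\<close>, the intermediate value
  theorem puts \<open>c\<close> in the range with a preimage at most \<open>z\<close>.\<close>

lemma less_ext_inverse_imp:
  assumes f: "strict_mono_on {0..} f" "continuous_on {0..} f"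
    and z: "0 \<le> z" and c: "f 0 \<le> c" "ereal z < ext_inverse f c"
  shows "f z < c"
proof (rule ccontr)
  assume "\<not> f z < c"
  then have "\<exists>w\<ge>0. w \<le> z \<and> f w = c"
    using c(1) z by (intro IVT') (auto intro: continuous_on_subset[OF f(2)])
  then obtain w where w: "0 \<le> w" "w \<le> z" "f w = c"
    by blast
  then have "the_inv_into {0..} f c = w"
    using f by (auto intro!: the_inv_into_f_eq strict_mono_on_imp_inj_on)
  moreover have "c \<in> f ` {0..}"
    using w by auto
  ultimately have "ext_inverse f c = ereal w"
    using c by (simp add: ext_inverse_def)
  with w c show False
    by simp
qed

text \<open>Positivity of \<open>z\<close> excludes the default value 0, its finiteness the value
  infinity.\<close>

lemma ext_inverse_eq_imp:
  assumes f: "strict_mono_on {0..} f" and z: "0 < z" "ext_inverse f c = ereal z"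
  shows "f z = c"
proof -
  have "c \<in> f ` {0..}" "the_inv_into {0..} f c = z"
    using z by (auto simp: ext_inverse_def zero_ereal_def split: if_splits)
  then show ?thesis
    using f_the_inv_into_f strict_mono_on_imp_inj_on[OF f] by metis
qed

text \<open>This and its counterpart on the left supply the slack for strict inequalities at box
  corners and for intermediate bounds.\<close>

lemma continuous_on_right_less:
  fixes f :: "real \<Rightarrow> real"
  assumes "continuous_on {0..} f" "0 \<le> a" "f a < c"
  shows "\<exists>b>a. f b < c"
proof -
  have "(f \<longlongrightarrow> f a) (at a within {0..})"
    using assms by (auto simp: continuous_on_def)
  then have "(f \<longlongrightarrow> f a) (at_right a)"
    by (rule tendsto_within_subset) (use assms in auto)
  then have "\<forall>\<^sub>F b in at_right a. f b < c"
    using assms by (intro order_tendstoD)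
  then have "\<forall>\<^sub>F b in at_right a. f b < c \<and> b > a"
    using eventually_at_right_less by (rule eventually_conj)
  then show ?thesis
    using eventually_happens'[OF trivial_limit_at_right_real] by blast
qed

lemma continuous_on_left_greater:
  fixes f :: "real \<Rightarrow> real"
  assumes "continuous_on {0..} f" "0 < a" "c < f a"
  shows "\<exists>b. 0 < b \<and> b < a \<and> c < f b"
proof -
  have "(f \<longlongrightarrow> f a) (at a within {0..})"
    using assms by (auto simp: continuous_on_def)
  then have "(f \<longlongrightarrow> f a) (at a within {0..a})"
    by (rule tendsto_within_subset) auto
  then have "(f \<longlongrightarrow> f a) (at_left a)"
    using \<open>0 < a\<close> by (simp add: at_within_Icc_at_left)
  then have "\<forall>\<^sub>F b in at_left a. c < f b"
    using assms by (intro order_tendstoD)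
  moreover have "\<forall>\<^sub>F b in at_left a. b \<in> {0<..<a}"
    using \<open>0 < a\<close> by (rule eventually_at_left_real)
  ultimately have "\<forall>\<^sub>F b in at_left a. c < f b \<and> b \<in> {0<..<a}"
    by (rule eventually_conj)
  then show ?thesis
    using eventually_happens'[OF trivial_limit_at_left_real] by fastforce
qed

lemma continuous_on_glue_zero:
  fixes u :: "real \<Rightarrow> real"
  assumes "continuous_on {0..} u" "continuous_on {..0} \<phi>" "\<And>t. t \<le> 0 \<Longrightarrow> u t = \<phi> t"
  shows "continuous_on UNIV u"
proof -
  have "continuous_on {..0} u"
    using assms(2) by (rule continuous_on_eq) (use assms(3) in auto)
  then have "continuous_on ({..0} \<union> {0..}) u"
    by (intro continuous_on_closed_Un assms(1)) auto
  then show ?thesis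
    by (metis UNIV_eq_I Un_iff atLeast_iff atMost_iff linear)
qed

theorem theorem3p15:
  fixes f1 f2 G1 G2 h1 h2 r1 r2 \<phi> \<psi> x y :: "real \<Rightarrow> real"
    and R1 R2 :: "real \<Rightarrow> real \<Rightarrow> real"
    and K :: real
  assumes f1: "f1 \<in> {0..} \<rightarrow> {0..}" "continuous_on {0..} f1" "strict_mono_on {0..} f1"
      "\<And>u. u > 0 \<Longrightarrow> f1 u > 0"
    and f2: "f2 \<in> {0..} \<rightarrow> {0..}" "continuous_on {0..} f2" "strict_mono_on {0..} f2"
      "\<And>u. u > 0 \<Longrightarrow> f2 u > 0"
    and K_sol: "K > 0" "ext_inverse f1 K = ereal (f2 K)"
    and K_unique: "\<And>u. u > 0 \<Longrightarrow> ext_inverse f1 u = ereal (f2 u) \<Longrightarrow> u = K"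
    and below_K: "\<And>u. f1 0 < u \<Longrightarrow> u < K \<Longrightarrow> ereal (f2 u) > ext_inverse f1 u"
    and above_K: "\<And>u. u > K \<Longrightarrow> ereal (f2 u) < ext_inverse f1 u"
    and h: "admissible_delay h1" "admissible_delay h2"
    and R: "admissible_kernel h1 R1" "admissible_kernel h2 R2"
    and r: "admissible_rate r1" "admissible_rate r2"
    and \<phi>: "continuous_on {..0} \<phi>" "bounded (\<phi> ` {..0})"
      "\<And>t. t < 0 \<Longrightarrow> \<phi> t \<ge> 0" "\<phi> 0 > 0"
    and \<psi>: "continuous_on {..0} \<psi>" "bounded (\<psi> ` {..0})"
      "\<And>t. t < 0 \<Longrightarrow> \<psi> t \<ge> 0" "\<psi> 0 > 0"
    and G1: "G1 \<in> {0..} \<rightarrow> {0..}" "continuous_on {0..} G1" "\<And>u. u > 0 \<Longrightarrow> G1 u > 0"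
    and G2: "G2 \<in> {0..} \<rightarrow> {0..}" "continuous_on {0..} G2" "\<And>u. u > 0 \<Longrightarrow> G2 u > 0"
    and sol: "PG_solution r1 G1 f1 h1 R1 r2 G2 f2 h2 R2 \<phi> \<psi> x y"
  shows "((\<lambda>t. (x t, y t)) \<longlongrightarrow> (K, f2 K)) at_top"
proof -

  \<comment> \<open>Sign conditions for \<open>f1 \<circ> f2\<close> and
    \<open>f2 \<circ> f1\<close>\<close>
  have f_le: "f1 a \<le> f1 b" "f2 a \<le> f2 b" if "0 \<le> a" "a \<le> b" for a b
    using that strict_mono_on_leD[OF f1(3)] strict_mono_on_leD[OF f2(3)] by auto
  have f_less: "f1 a < f1 b" "f2 a < f2 b" if "0 \<le> a" "a < b" for a b
    using that strict_mono_onD[OF f1(3)] strict_mono_onD[OF f2(3)] by auto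
  have f2_nonneg: "0 \<le> f2 a" if "0 \<le> a" for a
    using that f2(1) by auto
  have fK: "f1 (f2 K) = K"
    using ext_inverse_eq_imp[OF f1(3) _ K_sol(2)] f2(4)[OF K_sol(1)] .
  have K0: "f1 0 \<le> K"
    using f_le(1)[of 0 "f2 K"] fK f2(4)[OF K_sol(1)] by simp
  have g_above: "f1 (f2 u) < u" if "u > K" for u
    using that K_sol(1) K0 above_K[OF that] f2_nonneg[of u]
    by (intro less_ext_inverse_imp[OF f1(3,2)]) auto
  \<comment> \<open>Up to \<open>f1 0\<close> the hypothesis on the inverse is silent; there
    positivity of \<open>f2 u\<close> and strict monotonicity of \<open>f1\<close> suffice.\<close>
  have g_below: "u < f1 (f2 u)" if "0 < u" "u < K" for u
  proof (cases "u \<le> f1 0")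
    case True
    then show ?thesis
      using f_less(1)[of 0 "f2 u"] f2(4)[OF that(1)] by simp
  next
    case False
    then show ?thesis
      using below_K[of u] that f2_nonneg[of u] by (intro ext_inverse_less_imp[OF f1(3)]) auto
  qed
  \<comment> \<open>If \<open>f2 (f1 B) \<ge> B\<close>, then \<open>f1 B > K\<close>, so
    \<open>g_above\<close> gives \<open>f1 (f2 (f1 B)) < f1 B\<close>, against the monotonicity of
    \<open>f1\<close>. The lower counterpart is dual.\<close>
  have g'_above: "f2 (f1 B) < B" if "f2 K < B" for B
  proof (rule ccontr)
    assume *: "\<not> f2 (f1 B) < B"
    have "0 \<le> f1 B"
      using f1(1) that f2_nonneg[of K] K_sol(1) by auto
    then have "K < f1 B"
      using f_le(2)[of "f1 B" K] * that by (cases "K < f1 B") auto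
    from g_above[OF this] have "f2 (f1 B) < B"
      using f_le(1)[of B "f2 (f1 B)"] * that f2_nonneg[of K] K_sol(1) by (cases "B \<le> f2 (f1 B)") auto
    with * show False ..
  qed
  have g'_below: "B < f2 (f1 B)" if "0 < B" "B < f2 K" for B
  proof (rule ccontr)
    assume *: "\<not> B < f2 (f1 B)"
    have "0 < f1 B"
      using f1(4) that by simp
    then have "f1 B < K"
      using f_le(2)[of K "f1 B"] * that K_sol(1) by (cases "f1 B < K") auto
    from g_below[OF \<open>0 < f1 B\<close> this] have "B < f2 (f1 B)"
      using f_le(1)[of "f2 (f1 B)" B] * f2_nonneg[of "f1 B"] \<open>0 < f1 B\<close> by (cases "B < f2 (f1 B)") auto
    with * show False ..
  qed

  \<comment> \<open>The two equations as delayed relaxations\<close>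
  have ac: "locally_abs_continuous x" "locally_abs_continuous y"
    and eq: "satisfies_equation r1 G1 f1 h1 R1 x y" "satisfies_equation r2 G2 f2 h2 R2 y x"
    and init: "\<And>t. t \<le> 0 \<Longrightarrow> x t = \<phi> t" "\<And>t. t \<le> 0 \<Longrightarrow> y t = \<psi> t"
    using sol by (auto simp: PG_solution_def)
  have cont0: "continuous_on {0..} x" "continuous_on {0..} y"
    using ac by (auto intro: locally_abs_continuous_imp_continuous_on)
  then have cont: "continuous_on UNIV x" "continuous_on UNIV y"
    using \<phi>(1) \<psi>(1) init by (auto intro: continuous_on_glue_zero)
  interpret X: delayed_relaxation r1 G1 f1 h1 R1 x y
    using f1 h R r G1 ac eq cont by unfold_locales auto
  interpret Y: delayed_relaxation r2 G2 f2 h2 R2 y x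
    using f2 h R r G2 ac eq cont by unfold_locales auto

  \<comment> \<open>Positivity of the solution\<close>
  have past: "0 \<le> x t" "0 \<le> y t" if "t \<le> 0" for t
    using that \<phi>(3)[of t] \<phi>(4) \<psi>(3)[of t] \<psi>(4) init[OF that] by (cases "t = 0"; force)+
  have pos: "0 < x t \<and> 0 < y t" if "0 \<le> t" for t
  proof -
    \<comment> \<open>Positivity of each component relies on the other being nonnegative up to
      \<open>\<tau>\<close>, so both are continued together.\<close>
    have "0 < min (x t) (y t)"
    proof (rule continuous_positive_continuation[OF _ _ _ that])
      show "continuous_on {0..} (\<lambda>t. min (x t) (y t))"
        by (intro continuous_intros cont0)
      show "0 < min (x 0) (y 0)"
        using init \<phi>(4) \<psi>(4) by simp
      fix \<tau> :: real
      assume \<tau>: "0 < \<tau>" "\<And>s. 0 \<le> s \<Longrightarrow> s < \<tau> \<Longrightarrow> 0 < min (x s) (y s)" "0 \<le> min (x \<tau>) (y \<tau>)"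
      have "0 \<le> x s \<and> 0 \<le> y s" if "s \<le> \<tau>" for s
        using past[of s] \<tau>(2)[of s] \<tau>(3) that
        by (cases "s \<le> 0"; cases "s = \<tau>") auto
      then show "0 < min (x \<tau>) (y \<tau>)"
        using \<tau> X.stays_positive[OF \<tau>(1)] Y.stays_positive[OF \<tau>(1)] by (auto simp: min_less_iff_conj)
    qed
    then show ?thesis
      by simp
  qed
  have nonneg: "0 \<le> x t" "0 \<le> y t" for t
    using past[of t] pos[of t] by (cases "t \<le> 0"; force)+

  \<comment> \<open>Upper bounds\<close>
  txt \<open>A box \<open>[0,A) \<times> [0,B)\<close> with \<open>f1 B < A\<close> and \<open>f2 A < B\<close> cannot be left: as long as \<open>y \<le> B\<close>,
    the input of \<open>x\<close> is at most \<open>f1 B < A\<close>, and vice versa.\<close>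

  obtain Cx Cy where C: "\<And>t. t \<le> 0 \<Longrightarrow> x t \<le> Cx" "\<And>t. t \<le> 0 \<Longrightarrow> y t \<le> Cy"
    using \<phi>(2) \<psi>(2) init unfolding bounded_iff by (fastforce simp: abs_le_iff)
  obtain A B where AB: "Cx < A" "Cy < B" "f1 B < A" "f2 A < B" "K < A"
  proof -
    \<comment> \<open>\<open>B\<close> is taken above \<open>Cy\<close> and \<open>f2 A0\<close>,
      hence above \<open>f2 K\<close>, so that \<open>g'_above\<close> gives
      \<open>f2 (f1 B) < B\<close>. Thus \<open>f2\<close> is below \<open>B\<close> at
      \<open>max A0 (f1 B)\<close>, and by continuity still at a slightly larger
      \<open>A\<close>.\<close>
    define A0 where "A0 = max Cx K"
    define B where "B = max Cy (f2 A0) + 1"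
    have "f2 K < B"
      using f_le(2)[of K A0] K_sol(1) by (auto simp: A0_def B_def)
    then have "f2 (max A0 (f1 B)) < B"
      using g'_above[of B] by (auto simp: max_def[of A0] B_def)
    moreover have "0 \<le> max A0 (f1 B)"
      using K_sol(1) by (simp add: A0_def)
    ultimately obtain A where "max A0 (f1 B) < A" "f2 A < B"
      using continuous_on_right_less[OF f2(2)] by blast
    then show thesis
      by (intro that[of A B]) (auto simp: A0_def B_def)
  qed
  have below: "x t < A \<and> y t < B" if "0 \<le> t" for t
  proof -
    have "0 < min (A - x t) (B - y t)"
    proof (rule continuous_positive_continuation[OF _ _ _ that])
      show "continuous_on {0..} (\<lambda>t. min (A - x t) (B - y t))"
        by (intro continuous_intros cont0)
      show "0 < min (A - x 0) (B - y 0)"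
        using C[of 0] AB by simp
      fix \<tau> :: real
      assume \<tau>: "0 < \<tau>" "\<And>s. 0 \<le> s \<Longrightarrow> s < \<tau> \<Longrightarrow> 0 < min (A - x s) (B - y s)"
        "0 \<le> min (A - x \<tau>) (B - y \<tau>)"
      have *: "x s \<le> A \<and> y s \<le> B" if "s \<le> \<tau>" for s
        using C[of s] AB \<tau>(2)[of s] \<tau>(3) that
        by (cases "s \<le> 0"; cases "s = \<tau>") auto
      have "x \<tau> < A"
        using \<tau> * nonneg AB C[of 0] by (intro X.stays_below[of \<tau> A B]) auto
      moreover have "y \<tau> < B"
        using \<tau> * nonneg AB C[of 0] by (intro Y.stays_below[of \<tau> B A]) auto
      ultimately show "0 < min (A - x \<tau>) (B - y \<tau>)"
        by simp
    qed
    then show ?thesis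
      by simp
  qed

  \<comment> \<open>Lower bounds away from zero\<close>
  txt \<open>The initial functions may vanish before \<open>0\<close>, so the lower corner \<open>(\<delta>, \<eta>)\<close> of the box is only
    trapping from the time \<open>T\<close> on after which the delays no longer reach them.\<close>

  have "\<forall>\<^sub>F t in at_top. 0 \<le> h1 t \<and> 0 \<le> h2 t \<and> 0 \<le> t"
    using h eventually_ge_at_top[of "0::real"]
    by (auto simp: admissible_delay_def filterlim_at_top intro!: eventually_conj)
  then obtain T where T: "0 \<le> T" "\<And>t. t \<ge> T \<Longrightarrow> 0 \<le> h1 t \<and> 0 \<le> h2 t"
    by (auto simp: eventually_at_top_linorder)
  have "\<exists>m\<in>{0..T}. \<forall>t\<in>{0..T}. min (x m) (y m) \<le> min (x t) (y t)"
    using T(1) by (intro continuous_attains_inf continuous_intros continuous_on_subset[OF cont(1)]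
      continuous_on_subset[OF cont(2)]) auto
  then obtain m where m: "0 < m" "\<And>t. 0 \<le> t \<Longrightarrow> t \<le> T \<Longrightarrow> m \<le> x t \<and> m \<le> y t"
    using pos by (metis atLeastAtMost_iff min.bounded_iff min_less_iff_conj)
  obtain \<delta> \<eta> where \<delta>\<eta>: "0 < \<delta>" "0 < \<eta>" "\<delta> < m" "\<eta> < m" "\<delta> < f1 \<eta>" "\<eta> < f2 \<delta>" "\<delta> < K"
  proof -
    \<comment> \<open>Dual to the choice of \<open>A\<close> and \<open>B\<close>:
      \<open>\<eta> < f2 \<delta>0 < f2 K\<close> gives \<open>\<eta> < f2 (f1 \<eta>)\<close>, so
      \<open>f2\<close> exceeds \<open>\<eta>\<close> at \<open>min \<delta>0 (f1 \<eta>)\<close>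
      and still at a slightly smaller \<open>\<delta>\<close>. Staying below \<open>m\<close> puts
      the solution above the corner on all of \<open>[0, T]\<close>.\<close>
    define \<delta>0 where "\<delta>0 = min m K / 2"
    have \<delta>0: "0 < \<delta>0" "\<delta>0 < m" "\<delta>0 < K"
      using m(1) K_sol(1) by (auto simp: \<delta>0_def)
    define \<eta> where "\<eta> = min m (f2 \<delta>0) / 2"
    have \<eta>: "0 < \<eta>" "\<eta> < m" "\<eta> < f2 \<delta>0"
      using m(1) f2(4)[OF \<delta>0(1)] by (auto simp: \<eta>_def)
    have "\<eta> < f2 (f1 \<eta>)"
      using g'_below[of \<eta>] \<eta> f_less(2)[of \<delta>0 K] \<delta>0 by simp
    then have "\<eta> < f2 (min \<delta>0 (f1 \<eta>))"
      using \<eta> by (simp add: min_def)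
    moreover have "0 < min \<delta>0 (f1 \<eta>)"
      using \<delta>0 f1(4)[OF \<eta>(1)] by simp
    ultimately obtain \<delta> where "0 < \<delta>" "\<delta> < min \<delta>0 (f1 \<eta>)" "\<eta> < f2 \<delta>"
      using continuous_on_left_greater[OF f2(2)] by blast
    then show thesis
      using \<delta>0 \<eta> by (intro that[of \<delta> \<eta>]) auto
  qed
  have above_T: "\<delta> < x t \<and> \<eta> < y t" if "T \<le> t" for t
  proof -
    have "0 < min (x t - \<delta>) (y t - \<eta>)"
    proof (rule continuous_positive_continuation[OF _ _ _ that])
      show "continuous_on {T..} (\<lambda>t. min (x t - \<delta>) (y t - \<eta>))"
        by (intro continuous_intros continuous_on_subset[OF cont(1)] continuous_on_subset[OF cont(2)]) auto
      show "0 < min (x T - \<delta>) (y T - \<eta>)"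
        using m(2)[of T] T \<delta>\<eta> by simp
      fix \<tau> :: real
      assume \<tau>: "T < \<tau>" "\<And>s. T \<le> s \<Longrightarrow> s < \<tau> \<Longrightarrow> 0 < min (x s - \<delta>) (y s - \<eta>)"
        "0 \<le> min (x \<tau> - \<delta>) (y \<tau> - \<eta>)"
      \<comment> \<open>Windows after \<open>T\<close> may reach into \<open>[0, T]\<close>, where
        the minimum \<open>m\<close> provides the bounds.\<close>
      have *: "\<delta> \<le> x s \<and> \<eta> \<le> y s" if "0 \<le> s" "s \<le> \<tau>" for s
        using m(2)[of s] \<delta>\<eta> \<tau>(2)[of s] \<tau>(3) that
        by (cases "s \<le> T"; cases "s = \<tau>") auto
      have "\<delta> < x \<tau>"
        using T \<tau> * nonneg m(2)[of T] \<delta>\<eta> by (intro X.stays_above[of T \<tau> \<delta> \<eta>]) auto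
      moreover have "\<eta> < y \<tau>"
        using T \<tau> * nonneg m(2)[of T] \<delta>\<eta> by (intro Y.stays_above[of T \<tau> \<eta> \<delta>]) auto
      ultimately show "0 < min (x \<tau> - \<delta>) (y \<tau> - \<eta>)"
        by simp
    qed
    then show ?thesis
      by simp
  qed
  have box: "\<delta> \<le> x t \<and> x t \<le> A" "\<eta> \<le> y t \<and> y t \<le> B" if "0 \<le> t" for t
    using below[OF that] above_T[of t] m(2)[OF that] \<delta>\<eta> by (cases "t \<le> T"; force)+

  \<comment> \<open>Passing eventual bounds through the equations\<close>
  have y_le: "\<forall>\<^sub>F t in at_top. y t \<le> f2 a + \<epsilon>" if "\<forall>\<^sub>F t in at_top. x t \<le> a" "\<epsilon> > 0" for a \<epsilon>
    using Y.eventually_le[OF \<delta>\<eta>(2) box(2) nonneg(1) that] .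
  have y_ge: "\<forall>\<^sub>F t in at_top. f2 a - \<epsilon> \<le> y t" if "\<forall>\<^sub>F t in at_top. a \<le> x t" "0 \<le> a" "\<epsilon> > 0" for a \<epsilon>
    using Y.eventually_ge[OF \<delta>\<eta>(2) box(2) that(2,1,3)] .
  have x_le: "\<forall>\<^sub>F t in at_top. x t \<le> f1 (f2 a) + \<epsilon>"
    if a: "\<forall>\<^sub>F t in at_top. x t \<le> a" "0 \<le> a" "\<epsilon> > 0" for a \<epsilon>
  proof -
    \<comment> \<open>The gap between \<open>f2 a\<close> and \<open>b\<close> absorbs the error in
      the bound of \<open>y\<close>; the other half of \<open>\<epsilon>\<close> is the error of the
      equation for \<open>x\<close>.\<close>
    obtain b where b: "f2 a < b" "f1 b < f1 (f2 a) + \<epsilon> / 2"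
      using continuous_on_right_less[OF f1(2) f2_nonneg[OF a(2)], of "f1 (f2 a) + \<epsilon> / 2"] \<open>\<epsilon> > 0\<close> by auto
    then have "\<forall>\<^sub>F t in at_top. y t \<le> b"
      using y_le[OF a(1), of "b - f2 a"] by simp
    from X.eventually_le[OF \<delta>\<eta>(1) box(1) nonneg(2) this half_gt_zero[OF \<open>\<epsilon> > 0\<close>]]
    have "\<forall>\<^sub>F t in at_top. x t \<le> f1 b + \<epsilon> / 2" .
    then show ?thesis
      by eventually_elim (use b in auto)
  qed
  have x_ge: "\<forall>\<^sub>F t in at_top. f1 (f2 a) - \<epsilon> \<le> x t"
    if a: "\<forall>\<^sub>F t in at_top. a \<le> x t" "0 < a" "\<epsilon> > 0" for a \<epsilon>
  proof -
    obtain b where b: "0 < b" "b < f2 a" "f1 (f2 a) - \<epsilon> / 2 < f1 b"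
      using continuous_on_left_greater[OF f1(2) f2(4)[OF a(2)], of "f1 (f2 a) - \<epsilon> / 2"] \<open>\<epsilon> > 0\<close> by auto
    then have "\<forall>\<^sub>F t in at_top. b \<le> y t"
      using y_ge[OF a(1), of "f2 a - b"] a(2) by simp
    from X.eventually_ge[OF \<delta>\<eta>(1) box(1) less_imp_le[OF b(1)] this half_gt_zero[OF \<open>\<epsilon> > 0\<close>]]
    have "\<forall>\<^sub>F t in at_top. f1 b - \<epsilon> / 2 \<le> x t" .
    then show ?thesis
      by eventually_elim (use b in auto)
  qed

  \<comment> \<open>Eventual bounds of \<open>x\<close> near \<open>K\<close>\<close>
  have g_cont: "continuous_on {0..} (\<lambda>a. f1 (f2 a))"
    using f2_nonneg by (intro continuous_on_compose2[OF f1(2) f2(2)]) auto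
  have x_upper: "\<forall>\<^sub>F t in at_top. x t \<le> K + \<epsilon>" if "\<epsilon> > 0" for \<epsilon>
  proof (rule eventually_le_fixed_point[where A = A and g = "\<lambda>a. f1 (f2 a)"])
    show "continuous_on {K..A} (\<lambda>a. f1 (f2 a))"
      using K_sol(1) by (intro continuous_on_subset[OF g_cont]) auto
    show "\<forall>\<^sub>F t in at_top. x t \<le> A"
      using eventually_ge_at_top[of 0] by eventually_elim (use box in auto)
  qed (use AB g_above x_le K_sol(1) that in auto)
  have x_lower: "\<forall>\<^sub>F t in at_top. K - \<epsilon> \<le> x t" if "\<epsilon> > 0" for \<epsilon>
  proof -
    \<comment> \<open>Reflection turns lower bounds in \<open>[\<delta>, K]\<close> into upper
      bounds in \<open>[-K, -\<delta>]\<close>; positivity of \<open>\<delta>\<close> keeps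
      \<open>- a\<close> in the range where \<open>g_below\<close> and \<open>x_ge\<close>
      apply.\<close>
    have "\<forall>\<^sub>F t in at_top. - x t \<le> - K + \<epsilon>"
    proof (rule eventually_le_fixed_point[where A = "- \<delta>" and g = "\<lambda>a. - f1 (f2 (- a))"])
      show "continuous_on {- K..- \<delta>} (\<lambda>a. - f1 (f2 (- a)))"
        using \<delta>\<eta> by (intro continuous_on_minus continuous_on_compose2[OF g_cont] continuous_intros) auto
      show "\<forall>\<^sub>F t in at_top. - x t \<le> - \<delta>"
        using eventually_ge_at_top[of 0] by eventually_elim (use box in auto)
      show "- f1 (f2 (- a)) < a" if "- K < a" "a \<le> - \<delta>" for a
        using g_below[of "- a"] that \<delta>\<eta> by simp
      fix a e :: real
      assume a: "- K \<le> a" "a \<le> - \<delta>" "\<forall>\<^sub>F t in at_top. - x t \<le> a" "e > 0"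
      from a(3) have "\<forall>\<^sub>F t in at_top. - a \<le> x t"
        by eventually_elim simp
      from x_ge[OF this _ \<open>e > 0\<close>] have "\<forall>\<^sub>F t in at_top. f1 (f2 (- a)) - e \<le> x t"
        using a \<delta>\<eta> by simp
      then show "\<forall>\<^sub>F t in at_top. - x t \<le> - f1 (f2 (- a)) + e"
        by eventually_elim simp
    qed (use \<delta>\<eta> that in auto)
    then show ?thesis
      by eventually_elim simp
  qed

  \<comment> \<open>Limits of \<open>x\<close> and \<open>y\<close>\<close>
  have "(x \<longlongrightarrow> K) at_top"
  proof (rule order_tendstoI)
    fix a
    assume "a < K"
    then show "\<forall>\<^sub>F t in at_top. a < x t"
      using x_lower[of "(K - a) / 2"] by (auto elim!: eventually_mono simp: field_simps)
  next
    fix a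
    assume "K < a"
    then show "\<forall>\<^sub>F t in at_top. x t < a"
      using x_upper[of "(a - K) / 2"] by (auto elim!: eventually_mono simp: field_simps)
  qed
  moreover have "(y \<longlongrightarrow> f2 K) at_top"
  proof (rule order_tendstoI)
    fix a
    assume "a < f2 K"
    \<comment> \<open>\<open>f2 b\<close> lies strictly between \<open>a\<close> and
      \<open>f2 K\<close>, which leaves half of \<open>f2 b - a\<close> for the error of
      \<open>y_ge\<close>.\<close>
    then obtain b where b: "0 < b" "b < K" "a < f2 b"
      using continuous_on_left_greater[OF f2(2) K_sol(1)] by blast
    have "\<forall>\<^sub>F t in at_top. b \<le> x t"
      using x_lower[of "K - b"] b by simp
    from y_ge[OF this, of "(f2 b - a) / 2"] show "\<forall>\<^sub>F t in at_top. a < y t"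
      using b by (auto elim!: eventually_mono simp: field_simps)
  next
    fix a
    assume "f2 K < a"
    then obtain b where b: "K < b" "f2 b < a"
      using continuous_on_right_less[OF f2(2)] K_sol(1) by (meson less_imp_le)
    have "\<forall>\<^sub>F t in at_top. x t \<le> b"
      using x_upper[of "b - K"] b by simp
    from y_le[OF this, of "(a - f2 b) / 2"] show "\<forall>\<^sub>F t in at_top. y t < a"
      using b by (auto elim!: eventually_mono simp: field_simps)
  qed
  ultimately show ?thesis
    by (rule tendsto_Pair)
qed

end
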